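(* Let $G=(V,E)$ be a finite connected simple graph with $|V|\ge 2$ in which all vertices have the same degree. Let $(p_i,q_i,r_i)_{1\le i\le |V|}$ be triplets of non-negative reals with $p_i+q_i+r_i=1$ for all $i$, $r_i>0$ for all $2\le i\le |V|$ and $p_i>0$ for all $1\le i\le |V|-1$. Let $K$ be the transition matrix on $\mathrm{Subtrees}(G)$ described in the context. Then the Markov chain with transition matrix $K$ is reversible, and its unique invariant (probability) measure $\rho$ on $\mathrm{Subtrees}(G)$ gives the same weight $\nu_n$ to each element of $\mathrm{Subtrees}(G,n)$, for all $1\le n\le |V|$; that is, $\rho_t=\nu_{|t|}$ for all $t\in\mathrm{Subtrees}(G)$. The sequence $(\nu_k)_{1\le k\le |V|}$ satisfies $$\nu_m=2\nu_1\prod_{i=2}^m\left(\frac{p_{i-1}/(i-1)}{2\,r_i/i}\right)\quad\text{for } 2\le m\le |V|,\qquad \sum_{n=1}^{|V|}\nu_n\,|\mathrm{Subtrees}(G,n)|=1 .$$ Hence, if $\mathbf t\sim\rho$, the law of $\mathbf t$ conditional on $|\mathbf t|=n$ is the uniform distribution on $\mathrm{Subtrees}(G,n)$.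
   Context: $\mathrm{Subtrees}(G,n)$ is the set of subgraphs of $G$ that are trees with exactly $n$ vertices, and $\mathrm{Subtrees}(G)=\bigcup_{n\ge 1}\mathrm{Subtrees}(G,n)$; $|t|$ is the number of vertices of $t$. For a simple cycle $c=(c_0,\dots,c_{m-1})$ of $G$, $p_c$ is the probability distribution on the edges of $c$ with $p_c(\{c_i,c_{i+1 \bmod m}\})$ proportional to $\frac1{\deg_G(c_i)}+\frac1{\deg_G(c_{i+1 \bmod m})}$. For a tree $t$ and an oriented edge $\vec e=(v_1,v_2)$ with unoriented version $e=\{v_1,v_2\}\in E$, $\mathrm{Remove}(t,\vec e)$ is defined by: if $E(t)=\{e\}$, it is the tree reduced to the single vertex $v_1$; else, if $|E(t)|>1$ and $E(t)\setminus\{e\}$ is the edge set of a tree $t^\star$, it is $t^\star$; otherwise it is $t$. $\mathrm{Add}(t,e)$ is the graph with edge set $E(t)\cup\{e\}$ if $e$ is adjacent to $t$ (it has an endpoint in $t$), and is $t$ otherwise. Transition matrix $K$: given $X_0=t$, pick a vertex $\mathbf u$ uniformly in $V(t)$, then an oriented edge $\vec{\mathbf e}=(\mathbf u,\mathbf u')$ with $\mathbf u'$ uniform among the neighbours of $\mathbf u$ in $G$; write $\mathbf e$ for the unoriented edge. Independently pick $\mathbf c\in\{+1,0,-1\}$ with probabilities $p_{|t|},q_{|t|},r_{|t|}$ respectively. - If $\mathbf c=+1$: let $g=\mathrm{Add}(t,\mathbf e)$. If $g$ is a tree, set $X_1=g$. If $g$ has a cycle $c$, pick an edge $e$ of $c$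 with distribution $p_c$ and let $X_1$ be obtained from $t$ by adding $\mathbf e$ and then removing $e$. - If $\mathbf c=0$: set $X_1=t$. - If $\mathbf c=-1$: set $X_1=\mathrm{Remove}(t,\vec{\mathbf e})$. *)

theory Defs
  imports "HOL-Probability.Probability_Mass_Function"
begin

section \<open>Finite simple graphs, trees and cycles\<close>

datatype 'a ugraph = UGraph (verts: "'a set") (edges: "'a set set")

definition finite_simple_graph :: "'a ugraph \<Rightarrow> bool" where
  "finite_simple_graph G \<longleftrightarrow>
     finite (verts G) \<and> (\<forall>e\<in>edges G. e \<subseteq> verts G \<and> card e = 2)"

definition subgraph :: "'a ugraph \<Rightarrow> 'a ugraph \<Rightarrow> bool" where
  "subgraph H G \<longleftrightarrow> verts H \<subseteq> verts G \<and> edges H \<subseteq> edges G"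

definition neighbours :: "'a ugraph \<Rightarrow> 'a \<Rightarrow> 'a set" where
  "neighbours G v = {w. {v, w} \<in> edges G}"

definition vertex_degree :: "'a ugraph \<Rightarrow> 'a \<Rightarrow> nat" where
  "vertex_degree G v = card (neighbours G v)"

definition connected_graph :: "'a ugraph \<Rightarrow> bool" where
  "connected_graph G \<longleftrightarrow> verts G \<noteq> {} \<and>
     (\<forall>u\<in>verts G. \<forall>v\<in>verts G. (\<lambda>x y. {x, y} \<in> edges G)\<^sup>*\<^sup>* u v)"

definition cycle_edge :: "'a list \<Rightarrow> nat \<Rightarrow> 'a set" where
  "cycle_edge c i = {c ! i, c ! (Suc i mod length c)}"

definition cycle_edges :: "'a list \<Rightarrow> 'a set set" where
  "cycle_edges c = cycle_edge c ` {..<length c}"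

definition simple_cycle :: "'a ugraph \<Rightarrow> 'a list \<Rightarrow> bool" where
  "simple_cycle G c \<longleftrightarrow>
     length c \<ge> 3 \<and> distinct c \<and> set c \<subseteq> verts G \<and> cycle_edges c \<subseteq> edges G"

definition tree :: "'a ugraph \<Rightarrow> bool" where
  "tree t \<longleftrightarrow> finite_simple_graph t \<and> connected_graph t \<and> (\<nexists>c. simple_cycle t c)"

abbreviation num_verts :: "'a ugraph \<Rightarrow> nat" where
  "num_verts G \<equiv> card (verts G)"

definition subtrees_of_order :: "'a ugraph \<Rightarrow> nat \<Rightarrow> 'a ugraph set" where
  "subtrees_of_order G n = {t. subgraph t G \<and> tree t \<and> num_verts t = n}"

definition subtrees :: "'a ugraph \<Rightarrow> 'a ugraph set" where
  "subtrees G = (\<Union>n\<in>{1..}. subtrees_of_order G n)"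

text \<open>
  A tree with at least one edge is determined by its edge set
  (\<open>graph_of_edges_tree\<close>), so for nonempty \<open>F\<close> the phrase
  ``\<open>F\<close> is the edge set of a tree \<open>s\<close>'' amounts to
  \<open>tree (graph_of_edges F)\<close> with \<open>s = graph_of_edges F\<close>
  (\<open>edge_set_of_tree_iff\<close>).
\<close>

definition graph_of_edges :: "'a set set \<Rightarrow> 'a ugraph" where
  "graph_of_edges F = UGraph (\<Union>F) F"

lemma graph_of_edges_tree:
  assumes "tree t" and "edges t \<noteq> {}"
  shows "graph_of_edges (edges t) = t"
proof -
  have fsg: "finite_simple_graph t" and conn: "connected_graph t"
    using assms(1) by (simp_all add: tree_def)
  have sub: "\<Union>(edges t) \<subseteq> verts t"
    using fsg by (auto simp: finite_simple_graph_def)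
  have "v \<in> \<Union>(edges t)" if v: "v \<in> verts t" for v
  proof -
    obtain e where e: "e \<in> edges t" using assms(2) by blast
    then have "card e = 2" using fsg by (simp add: finite_simple_graph_def)
    then have "e \<noteq> {}" by auto
    then obtain w where w: "w \<in> e" by blast
    show ?thesis
    proof (cases "v = w")
      case True
      then show ?thesis using e w by blast
    next
      case False
      have "w \<in> verts t" using sub e w by blast
      then have "(\<lambda>x y. {x, y} \<in> edges t)\<^sup>*\<^sup>* v w"
        using conn v by (simp add: connected_graph_def)
      then obtain y where "{v, y} \<in> edges t"
        using False by (cases rule: converse_rtranclpE) auto
      then show ?thesis by blast
    qed
  qed
  then have "\<Union>(edges t) = verts t" using sub by blast
  then show ?thesis by (simp add: graph_of_edges_def)
qed

lemma edge_set_of_tree_iff: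
  assumes "F \<noteq> {}"
  shows "tree s \<and> edges s = F \<longleftrightarrow> tree (graph_of_edges F) \<and> s = graph_of_edges F"
  using assms graph_of_edges_tree[of s] by (metis graph_of_edges_def ugraph.sel(2))


section \<open>The transition kernel\<close>

definition add_edge :: "'a ugraph \<Rightarrow> 'a set \<Rightarrow> 'a ugraph" where
  "add_edge t e =
     (if e \<inter> verts t \<noteq> {} then graph_of_edges (edges t \<union> {e}) else t)"

text \<open>The second argument is an oriented edge.\<close>

definition remove_edge :: "'a ugraph \<Rightarrow> 'a \<times> 'a \<Rightarrow> 'a ugraph" where
  "remove_edge t = (\<lambda>(v1, v2).
     let e = {v1, v2} in
     if edges t = {e} then UGraph {v1} {}
     else if card (edges t) > 1 \<and> tree (graph_of_edges (edges t - {e}))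
       then graph_of_edges (edges t - {e})
     else t)"

definition delete_edge :: "'a ugraph \<Rightarrow> 'a set \<Rightarrow> 'a ugraph" where
  "delete_edge g e = UGraph (verts g) (edges g - {e})"

definition cycle_weight :: "'a ugraph \<Rightarrow> 'a set \<Rightarrow> real" where
  "cycle_weight G e = (\<Sum>v\<in>e. 1 / real (vertex_degree G v))"

definition cycle_pmf :: "'a ugraph \<Rightarrow> 'a list \<Rightarrow> 'a set pmf" where
  "cycle_pmf G c = embed_pmf (\<lambda>e.
     if e \<in> cycle_edges c
     then cycle_weight G e / (\<Sum>e'\<in>cycle_edges c. cycle_weight G e') else 0)"

definition choice_pmf :: "real \<Rightarrow> real \<Rightarrow> real \<Rightarrow> int pmf" where
  "choice_pmf a b d = embed_pmf (\<lambda>c.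
     if c = 1 then a else if c = 0 then b else if c = -1 then d else 0)"

text \<open>
  \<open>subtree_kernel G p q r t\<close> is the row of index \<open>t\<close> of the transition matrix. The choice of
  \<open>c\<close> in the case of a cycle is harmless: \<open>add_edge t e\<close> has at most one cycle up to
  rotation and reversal when \<open>t\<close> is a tree, and \<open>cycle_pmf\<close> only depends on its edges.
\<close>

definition subtree_kernel ::
  "'a ugraph \<Rightarrow> (nat \<Rightarrow> real) \<Rightarrow> (nat \<Rightarrow> real) \<Rightarrow> (nat \<Rightarrow> real) \<Rightarrow> 'a ugraph \<Rightarrow> 'a ugraph pmf"
where
  "subtree_kernel G p q r t = do {
     u \<leftarrow> pmf_of_set (verts t);
     u' \<leftarrow> pmf_of_set (neighbours G u);
     c \<leftarrow> choice_pmf (p (num_verts t)) (q (num_verts t)) (r (num_verts t));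
     if c = 1 then
       (let g = add_edge t {u, u'} in
        if tree g then return_pmf g
        else map_pmf (delete_edge g) (cycle_pmf G (SOME c. simple_cycle g c)))
     else if c = 0 then return_pmf t
     else return_pmf (remove_edge t (u, u'))
   }"


section \<open>Invariance and reversibility\<close>

text \<open>
  On a finite state space \<open>S\<close>, \<open>bind_pmf \<rho> K = \<rho>\<close> says that
  \<open>(\<Sum>s\<in>S. \<rho>\<^sub>s K\<^sub>s\<^sub>t) = \<rho>\<^sub>t\<close> for all \<open>t\<close>, including those outside \<open>S\<close>.
\<close>

definition invariant_pmf :: "'s set \<Rightarrow> ('s \<Rightarrow> 's pmf) \<Rightarrow> 's pmf \<Rightarrow> bool" where
  "invariant_pmf S K \<rho> \<longleftrightarrow> set_pmf \<rho> \<subseteq> S \<and> bind_pmf \<rho> K = \<rho>"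

definition reversible_wrt :: "'s set \<Rightarrow> ('s \<Rightarrow> 's pmf) \<Rightarrow> 's pmf \<Rightarrow> bool" where
  "reversible_wrt S K \<rho> \<longleftrightarrow>
     (\<forall>s\<in>S. \<forall>t\<in>S. pmf \<rho> s * pmf (K s) t = pmf \<rho> t * pmf (K t) s)"

end

theory Submission
  imports Defs "HOL-Library.Transitive_Closure_Table"
begin

text \<open>
  The law \<open>\<rho>\<close> is found from detailed balance. On a \<open>d\<close>-regular graph the pair
  \<open>(u, u')\<close> drawn by the kernel is uniform among the \<open>n * d\<close> pairs, called darts here, formed by a
  vertex of \<open>t\<close> and a neighbour of it in \<open>G\<close>, where \<open>n\<close> is the order of \<open>t\<close>. Each off-diagonal
  entry \<open>K t s\<close> is therefore a sum over darts divided by \<open>n * d\<close>, and two kinds of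
  moves have to be compared with their reversals.

  A move between distinct trees of the same order adds an edge \<open>e\<close> that closes a cycle and deletes another
  edge \<open>e'\<close> of this cycle. Both directions pass through the same unicyclic graph \<open>t \<union> s\<close>, both
  \<open>e\<close> and \<open>e'\<close> lie on its cycle, and by regularity the deleted edge is uniform on the cycle. Hence
  \<open>K t s = K s t\<close> (\<open>add_prob_same_size_sym\<close>, \<open>kernel_same_size_sym\<close>).

  A move from order \<open>n\<close> to order \<open>n + 1\<close> attaches a leaf along a single dart, with
  probability \<open>p n / (n * d)\<close>. The reversal removes this edge; either orientation of the edge
  does so, except when the result is a single vertex, where the orientation decides which endpoint
  survives (\<open>remove_edge_darts\<close>). The reversal thus has probability
  \<open>2 * r (n + 1) / ((n + 1) * d)\<close> if \<open>n \<ge> 2\<close>, and half of that if \<open>n = 1\<close>. A weight depending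
  on the order only, and given by the stated product, balances the two (\<open>weight_Suc\<close>,
  \<open>detailed_balance\<close>); the exceptional case \<open>n = 1\<close> produces the factor 2 in front of the product.

  Uniqueness follows from irreducibility by the maximum principle
  (\<open>invariant_pmf_iff_reversible\<close>). Every subtree is obtained from a single vertex by attaching
  leaves, leaf moves are possible in both directions, and two adjacent vertices are linked through the edge
  that joins them (\<open>irreducible\<close>).

  The graph theory behind this is the characterisation of trees as the connected
  graphs with one edge less than vertices (\<open>tree_iff_edge_count\<close>), which turns every verification that a
  move produces a tree into a count of edges.
\<close>

section \<open>Walks and connectedness\<close>

definition reach :: "'a ugraph \<Rightarrow> 'a \<Rightarrow> 'a \<Rightarrow> bool" where
  "reach g = (\<lambda>x y. {x, y} \<in> edges g)\<^sup>*\<^sup>*"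

lemma connected_graph_iff_reach:
  "connected_graph g \<longleftrightarrow> verts g \<noteq> {} \<and> (\<forall>u\<in>verts g. \<forall>v\<in>verts g. reach g u v)"
  by (simp add: connected_graph_def reach_def)

lemma reach_refl: "reach g x x"
  by (simp add: reach_def)

lemma reach_edge: "{x, y} \<in> edges g \<Longrightarrow> reach g x y"
  by (simp add: reach_def r_into_rtranclp)

lemma reach_trans: "reach g x y \<Longrightarrow> reach g y z \<Longrightarrow> reach g x z"
  by (simp add: reach_def)

lemma reach_induct [consumes 1, case_names refl step]:
  assumes "reach g x y" and "P x"
    and "\<And>y z. reach g x y \<Longrightarrow> {y, z} \<in> edges g \<Longrightarrow> P y \<Longrightarrow> P z"
  shows "P y"
  using assms unfolding reach_def by (rule rtranclp_induct)

lemma reach_sym: "reach g x y \<Longrightarrow> reach g y x"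
proof (induction rule: reach_induct)
  case (step y z)
  then have "reach g z y" by (intro reach_edge) (simp add: insert_commute)
  with step.IH show ?case by (meson reach_trans)
qed (rule reach_refl)

lemma reach_mono:
  assumes "reach g x y" and "edges g \<subseteq> edges h"
  shows "reach h x y"
  using assms(1)
proof (induction rule: reach_induct)
  case (step y z)
  then have "reach h y z" using assms(2) by (intro reach_edge) blast
  with step.IH show ?case by (rule reach_trans)
qed (rule reach_refl)

lemma edge_endpoints:
  assumes "finite_simple_graph g" and "{x, y} \<in> edges g"
  shows "x \<in> verts g" "y \<in> verts g" "x \<noteq> y"
  using assms by (auto simp: finite_simple_graph_def)

lemma finite_edges: "finite_simple_graph g \<Longrightarrow> finite (edges g)"
  by (rule finite_subset[of _ "Pow (verts g)"]) (auto simp: finite_simple_graph_def)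

lemma connected_graphI:
  assumes "v \<in> verts g" and "\<And>x. x \<in> verts g \<Longrightarrow> reach g v x"
  shows "connected_graph g"
  unfolding connected_graph_iff_reach
proof (intro conjI ballI)
  fix x y assume "x \<in> verts g" "y \<in> verts g"
  then show "reach g x y"
    using assms(2) reach_sym[of g v x] reach_trans[of g x v y] by blast
qed (use assms(1) in blast)

section \<open>Trees as connected graphs with few edges\<close>

definition attach_leaf :: "'a ugraph \<Rightarrow> 'a \<Rightarrow> 'a \<Rightarrow> 'a ugraph" where
  "attach_leaf t u w = UGraph (insert w (verts t)) (insert {u, w} (edges t))"

lemma verts_attach_leaf [simp]: "verts (attach_leaf t u w) = insert w (verts t)"
  and edges_attach_leaf [simp]: "edges (attach_leaf t u w) = insert {u, w} (edges t)"
  by (simp_all add: attach_leaf_def)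

lemma attach_leaf_fsg:
  assumes "finite_simple_graph t" "u \<in> verts t" "w \<notin> verts t"
  shows "finite_simple_graph (attach_leaf t u w)"
  using assms by (auto simp: finite_simple_graph_def card_insert_if)

lemma attach_leaf_connected:
  assumes "connected_graph t" "u \<in> verts t"
  shows "connected_graph (attach_leaf t u w)"
proof (rule connected_graphI[of u])
  fix x assume x: "x \<in> verts (attach_leaf t u w)"
  have "reach (attach_leaf t u w) u x" if "x \<in> verts t"
    by (rule reach_mono[of t]) (use assms that in \<open>auto simp: connected_graph_iff_reach\<close>)
  moreover have "reach (attach_leaf t u w) u w" by (rule reach_edge) simp
  ultimately show "reach (attach_leaf t u w) u x" using x by auto
qed (use assms in simp)

lemma attach_leaf_card:
  assumes "finite_simple_graph t" "w \<notin> verts t"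
  shows "num_verts (attach_leaf t u w) = Suc (num_verts t)"
    and "card (edges (attach_leaf t u w)) = Suc (card (edges t))"
proof -
  have "finite (verts t)" using assms by (simp add: finite_simple_graph_def)
  then show "num_verts (attach_leaf t u w) = Suc (num_verts t)" using assms by simp
  have "{u, w} \<notin> edges t" using edge_endpoints(2)[OF assms(1)] assms(2) by blast
  then show "card (edges (attach_leaf t u w)) = Suc (card (edges t))"
    using finite_edges[OF assms(1)] by simp
qed

text \<open>
  A walk in \<open>g\<close> that leaves the vertex set of \<open>H\<close> has to use such an edge.
\<close>

lemma crossing_edge:
  assumes g: "finite_simple_graph g" "connected_graph g"
    and H: "verts H \<subseteq> verts g" "verts H \<noteq> {}" "verts H \<noteq> verts g"
  shows "\<exists>u\<in>verts H. \<exists>w\<in>verts g - verts H. {u, w} \<in> edges g"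
proof (rule ccontr)
  assume no: "\<not> ?thesis"
  obtain x y where x: "x \<in> verts H" and y: "y \<in> verts g" "y \<notin> verts H" using H by blast
  then have "reach g x y" using g H by (auto simp: connected_graph_iff_reach)
  then have "y \<in> verts H"
  proof (induction rule: reach_induct)
    case (step y z)
    then show ?case using no edge_endpoints(2)[OF g(1)] by blast
  qed (rule x)
  with y show False by simp
qed

text \<open>
  Attaching crossing edges one at a time adds one vertex and one edge per step. The case
  \<open>n = num_verts g\<close> is the existence of a spanning tree; the other values of \<open>n\<close> give
  subtrees of every order and, applied to a tree \<open>g\<close>, show that \<open>g\<close> arises by attaching
  a leaf.
\<close>

lemma grow_connected_subgraph:
  assumes g: "finite_simple_graph g" "connected_graph g" and "1 \<le> n" "n \<le> num_verts g"
  shows "\<exists>H. subgraph H g \<and> finite_simple_graph H \<and> connected_graph H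
           \<and> num_verts H = n \<and> card (edges H) + 1 = n"
  using assms(3,4)
proof (induction n rule: nat_induct_at_least)
  case base
  obtain v where "v \<in> verts g" using g by (auto simp: connected_graph_def)
  then show ?case
    by (intro exI[of _ "UGraph {v} {}"])
       (auto simp: subgraph_def finite_simple_graph_def connected_graph_def)
next
  case (Suc n)
  then obtain H where H: "subgraph H g" "finite_simple_graph H" "connected_graph H"
    "num_verts H = n" "card (edges H) + 1 = n" by auto
  then have "verts H \<noteq> {}" "verts H \<noteq> verts g" "verts H \<subseteq> verts g"
    using Suc.prems by (auto simp: subgraph_def connected_graph_def)
  then obtain u w where uw: "u \<in> verts H" "w \<in> verts g - verts H" "{u, w} \<in> edges g"
    using crossing_edge[OF g, of H] by blast
  then show ?case
    using H attach_leaf_fsg[of H u w] attach_leaf_connected[of H u w] attach_leaf_card[of H w u]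
    by (intro exI[of _ "attach_leaf H u w"]) (auto simp: subgraph_def)
qed

lemma connected_edge_bound:
  assumes g: "finite_simple_graph g" "connected_graph g"
  shows "num_verts g \<le> card (edges g) + 1"
proof -
  have "num_verts g \<ge> 1"
    using g by (auto simp: finite_simple_graph_def connected_graph_def Suc_le_eq card_gt_0_iff)
  then obtain H where "subgraph H g" "card (edges H) + 1 = num_verts g"
    using grow_connected_subgraph[OF g, of "num_verts g"] by auto
  then show ?thesis
    using card_mono[OF finite_edges[OF g(1)], of "edges H"] by (auto simp: subgraph_def)
qed

lemma rtrancl_path_last_Cons: "rtrancl_path R x xs y \<Longrightarrow> last (x # xs) = y"
  by (induction rule: rtrancl_path.induct) auto

text \<open>
  A walk from \<open>x\<close> to \<open>y\<close> can be shortened to a path, and the edge \<open>{x, y}\<close>, which this path does not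
  use, closes it to a cycle. The path has at least three vertices because \<open>x\<close> and \<open>y\<close> are
  distinct and not adjacent in \<open>H\<close>.
\<close>

lemma chord_gives_cycle:
  assumes fsg: "finite_simple_graph H" and xy: "x \<in> verts H" "y \<in> verts H" "x \<noteq> y"
    and r: "reach H x y" and no: "{x, y} \<notin> edges H"
    and g: "verts H \<subseteq> verts g" "insert {x, y} (edges H) \<subseteq> edges g"
  shows "\<exists>c. simple_cycle g c"
proof -
  obtain xs where xs: "rtrancl_path (\<lambda>x y. {x, y} \<in> edges H) x xs y" "distinct (x # xs)"
    using r unfolding reach_def by (metis rtranclp_eq_rtrancl_path rtrancl_path_distinct)
  define c where "c = x # xs"
  have step: "{c ! i, c ! Suc i} \<in> edges H" if "Suc i < length c" for i
    using rtrancl_path_nth[OF xs(1), of i] that by (simp add: c_def)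
  have last: "last c = y" using rtrancl_path_last_Cons[OF xs(1)] by (simp add: c_def)
  have len: "length c \<ge> 3"
  proof (rule ccontr)
    assume "\<not> ?thesis"
    then consider "xs = []" | a where "xs = [a]"
      by (cases xs rule: list.exhaust) (auto simp: c_def Suc_le_eq)
    then show False
      using last xy no step[of 0] by cases (auto simp: c_def)
  qed
  have sub: "set c \<subseteq> verts H"
  proof
    fix z assume "z \<in> set c"
    then obtain i where i: "i < length c" "z = c ! i" by (metis in_set_conv_nth)
    show "z \<in> verts H"
    proof (cases i)
      case 0 then show ?thesis using i xy by (simp add: c_def)
    next
      case (Suc j) then show ?thesis using edge_endpoints(2)[OF fsg step[of j]] i by simp
    qed
  qed
  have "cycle_edge c i \<in> edges g" if i: "i < length c" for i
  proof (cases "Suc i = length c")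
    case True
    then have "c ! i = y" using last by (metis diff_Suc_1 last_conv_nth length_0_conv nat.distinct(1))
    moreover have "c ! 0 = x" by (simp add: c_def)
    ultimately show ?thesis using True g by (auto simp: cycle_edge_def insert_commute)
  next
    case False
    then show ?thesis using i step[of i] g by (auto simp: cycle_edge_def)
  qed
  moreover have "distinct c" using xs(2) by (simp add: c_def)
  ultimately have "simple_cycle g c"
    using len sub g(1) by (auto simp: simple_cycle_def cycle_edges_def)
  then show ?thesis ..
qed

text \<open>
  Length 3 is where this starts to be true: on two vertices both positions give the same edge.
\<close>

lemma cycle_edge_neq:
  assumes "distinct c" "length c \<ge> 3" "i < length c" "j < length c" "i \<noteq> j"
  shows "cycle_edge c i \<noteq> cycle_edge c j"
proof
  let ?s = "\<lambda>i. Suc i mod length c"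
  assume "cycle_edge c i = cycle_edge c j"
  moreover have "?s i < length c" "?s j < length c" using assms by (auto intro: mod_less_divisor)
  ultimately have "i = ?s j" "j = ?s i"
    using assms by (auto simp: cycle_edge_def doubleton_eq_iff nth_eq_iff_index_eq)
  then have "i = (if Suc j = length c then 0 else Suc j)" "j = (if Suc i = length c then 0 else Suc i)"
    using assms(3,4) by (metis Suc_lessI mod_less mod_self)+
  then show False using assms(2) by (split if_split_asm; arith)
qed

text \<open>
  Starting just behind the edge at position \<open>i\<close>, one can walk along the remaining
  \<open>length c - 1\<close> edges to its other endpoint.
\<close>

lemma reach_around_cycle:
  assumes c: "simple_cycle g c" and i: "i < length c"
  shows "k < length c \<Longrightarrow>
    reach (delete_edge g (cycle_edge c i)) (c ! (Suc i mod length c)) (c ! ((Suc i + k) mod length c))"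
proof (induction k)
  case (Suc k)
  let ?m = "length c" and ?j = "(Suc i + k) mod length c"
  have "?j \<noteq> i"
    using Suc.prems i by (cases "Suc i + k < ?m") (auto simp: mod_if)
  moreover have j: "?j < ?m" using i by (intro mod_less_divisor) linarith
  ultimately have "cycle_edge c ?j \<noteq> cycle_edge c i"
    using c i by (intro cycle_edge_neq) (auto simp: simple_cycle_def)
  moreover from j have "cycle_edge c ?j \<in> edges g" using c
    by (auto simp: simple_cycle_def cycle_edges_def)
  moreover have "cycle_edge c ?j = {c ! ?j, c ! ((Suc i + Suc k) mod ?m)}"
    by (simp add: cycle_edge_def mod_Suc_eq)
  ultimately have "{c ! ?j, c ! ((Suc i + Suc k) mod ?m)} \<in> edges (delete_edge g (cycle_edge c i))"
    by (simp add: delete_edge_def)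
  then show ?case using reach_trans[OF Suc.IH reach_edge] Suc.prems by simp
qed (simp add: reach_refl)

text \<open>
  Each use of the deleted edge is replaced by the detour along the rest of the cycle.
\<close>

lemma delete_cycle_edge_connected:
  assumes g: "connected_graph g" and c: "simple_cycle g c" and e: "e \<in> cycle_edges c"
  shows "connected_graph (delete_edge g e)"
proof -
  let ?h = "delete_edge g e"
  obtain i where i: "i < length c" "e = cycle_edge c i" using e by (auto simp: cycle_edges_def)
  let ?x = "c ! i" and ?y = "c ! (Suc i mod length c)"
  have "Suc i + (length c - 1) = i + length c" using i(1) by linarith
  then have "(Suc i + (length c - 1)) mod length c = i" using i(1) by (metis mod_add_self2 mod_less)
  then have "reach ?h ?y ?x"
    using reach_around_cycle[OF c i(1), of "length c - 1"] i by auto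
  then have ends: "reach ?h ?x ?y" "reach ?h ?y ?x" using reach_sym by metis+
  have "reach ?h a b" if "reach g a b" for a b
    using that
  proof (induction rule: reach_induct)
    case (step b b')
    show ?case
    proof (cases "{b, b'} = e")
      case True
      then have "reach ?h b b'" using ends i(2) reach_refl by (auto simp: cycle_edge_def doubleton_eq_iff)
      with step.IH show ?thesis by (rule reach_trans)
    next
      case False
      then have "{b, b'} \<in> edges ?h" using step by (simp add: delete_edge_def)
      then show ?thesis using reach_trans[OF step.IH reach_edge] by simp
    qed
  qed (rule reach_refl)
  then show ?thesis using g by (auto simp: connected_graph_iff_reach delete_edge_def)
qed

lemma delete_edge_fsg: "finite_simple_graph g \<Longrightarrow> finite_simple_graph (delete_edge g e)"
  by (auto simp: finite_simple_graph_def delete_edge_def)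

text \<open>
  A connected graph contains a spanning subgraph with \<open>num_verts t - 1\<close> edges. Any further edge would close a
  cycle, so a tree has no further edge. Conversely, if a graph with this number of edges
  had a cycle, deleting an edge of the cycle would leave a connected graph with too few edges.
\<close>

lemma tree_iff_edge_count:
  "tree t \<longleftrightarrow> finite_simple_graph t \<and> connected_graph t \<and> card (edges t) + 1 = num_verts t"
proof (intro iffI conjI)
  assume t: "tree t"
  then show fsg: "finite_simple_graph t" and conn: "connected_graph t" by (auto simp: tree_def)
  have "num_verts t \<ge> 1"
    using fsg conn by (auto simp: finite_simple_graph_def connected_graph_def Suc_le_eq card_gt_0_iff)
  then obtain H where H: "subgraph H t" "finite_simple_graph H" "connected_graph H"
    "num_verts H = num_verts t" "card (edges H) + 1 = num_verts t"
    using grow_connected_subgraph[OF fsg conn, of "num_verts t"] by auto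
  have V: "verts H = verts t"
    using H fsg by (intro card_subset_eq) (auto simp: subgraph_def finite_simple_graph_def)
  have "edges t \<subseteq> edges H"
  proof
    fix e assume e: "e \<in> edges t"
    then obtain x y where xy: "e = {x, y}" using fsg by (metis card_2_iff finite_simple_graph_def)
    have ends: "x \<in> verts t" "y \<in> verts t" "x \<noteq> y" using edge_endpoints[OF fsg] e xy by auto
    show "e \<in> edges H"
    proof (rule ccontr)
      assume "e \<notin> edges H"
      then have "\<exists>c. simple_cycle t c"
        using H V e ends xy
        by (intro chord_gives_cycle[of H x y t]) (auto simp: connected_graph_iff_reach subgraph_def)
      then show False using t by (simp add: tree_def)
    qed
  qed
  then have "edges H = edges t" using H by (auto simp: subgraph_def)
  then show "card (edges t) + 1 = num_verts t" using H by simp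
next
  assume a: "finite_simple_graph t \<and> connected_graph t \<and> card (edges t) + 1 = num_verts t"
  have False if c: "simple_cycle t c" for c
  proof -
    have "length c > 0" using c by (auto simp: simple_cycle_def)
    then have "cycle_edge c 0 \<in> cycle_edges c" by (simp add: cycle_edges_def)
    then have e: "cycle_edge c 0 \<in> cycle_edges c" "cycle_edge c 0 \<in> edges t"
      using c by (auto simp: simple_cycle_def)
    have "num_verts t \<le> card (edges (delete_edge t (cycle_edge c 0))) + 1"
      using connected_edge_bound[OF delete_edge_fsg delete_cycle_edge_connected[OF _ c e(1)]] a
      by (simp add: delete_edge_def)
    moreover have "card (edges t) > 0" using e a finite_edges by (auto simp: card_gt_0_iff)
    ultimately show False using a e by (simp add: delete_edge_def finite_edges)
  qed
  with a show "tree t" by (auto simp: tree_def)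
qed

lemma tree_attach_leaf:
  assumes "tree t" "u \<in> verts t" "w \<notin> verts t"
  shows "tree (attach_leaf t u w)"
  using assms attach_leaf_fsg[of t u w] attach_leaf_connected[of t u w] attach_leaf_card[of t w u]
  by (simp add: tree_iff_edge_count)

lemma ugraph_eqI: "verts g = verts h \<Longrightarrow> edges g = edges h \<Longrightarrow> g = h"
  by (cases g; cases h) simp

section \<open>The finite set of subtrees\<close>

lemma subtrees_iff: "t \<in> subtrees G \<longleftrightarrow> subgraph t G \<and> tree t"
proof
  assume t: "subgraph t G \<and> tree t"
  then have "num_verts t \<ge> 1"
    by (auto simp: tree_iff_edge_count)
  with t show "t \<in> subtrees G" by (auto simp: subtrees_def subtrees_of_order_def)
qed (auto simp: subtrees_def subtrees_of_order_def)

lemma subtrees_of_order_eq: "subtrees_of_order G n = {t \<in> subtrees G. num_verts t = n}"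
  by (auto simp: subtrees_iff subtrees_of_order_def)

lemma finite_subtrees:
  assumes "finite_simple_graph G"
  shows "finite (subtrees G)"
proof (rule finite_subset)
  show "subtrees G \<subseteq> (\<lambda>(V, E). UGraph V E) ` (Pow (verts G) \<times> Pow (edges G))"
  proof
    fix t assume "t \<in> subtrees G"
    then have "t = (\<lambda>(V, E). UGraph V E) (verts t, edges t)"
      "(verts t, edges t) \<in> Pow (verts G) \<times> Pow (edges G)"
      by (auto simp: subtrees_iff subgraph_def)
    then show "t \<in> (\<lambda>(V, E). UGraph V E) ` (Pow (verts G) \<times> Pow (edges G))" by (rule image_eqI)
  qed
qed (use assms finite_edges[of G] in \<open>auto simp: finite_simple_graph_def\<close>)

section \<open>Finitely supported distributions and reversible chains\<close>

lemma pmf_embed_finite_support: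
  assumes "finite A" and "\<And>x. x \<in> A \<Longrightarrow> 0 \<le> f x" and "sum f A = 1"
  shows "pmf (embed_pmf (\<lambda>x. if x \<in> A then f x else 0)) x = (if x \<in> A then f x else 0)"
proof (rule pmf_embed_pmf)
  have "(\<integral>\<^sup>+ x. ennreal (if x \<in> A then f x else 0) \<partial>count_space UNIV) = (\<Sum>x\<in>A. ennreal (if x \<in> A then f x else 0))"
    using assms(1) by (intro nn_integral_count_space') auto
  also have "\<dots> = (\<Sum>x\<in>A. ennreal (f x))" by (intro sum.cong) auto
  also have "\<dots> = ennreal (sum f A)" using assms(2) by (rule sum_ennreal)
  finally show "(\<integral>\<^sup>+ x. ennreal (if x \<in> A then f x else 0) \<partial>count_space UNIV) = 1"
    using assms(3) by simp
qed (use assms(2) in auto)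

lemma pmf_bind_choice_pmf:
  assumes "a \<ge> 0" "b \<ge> 0" "c \<ge> 0" "a + b + c = 1"
  shows "pmf (bind_pmf (choice_pmf a b c) f) x
       = a * pmf (f 1) x + b * pmf (f 0) x + c * pmf (f (-1)) x"
proof -
  define h :: "int \<Rightarrow> real" where "h = (\<lambda>i. if i = 1 then a else if i = 0 then b else c)"
  have eq: "choice_pmf a b c = embed_pmf (\<lambda>i. if i \<in> {1, 0, -1} then h i else 0)"
    unfolding choice_pmf_def h_def by (rule arg_cong[of _ _ embed_pmf]) auto
  have pmf: "pmf (choice_pmf a b c) i = (if i \<in> {1, 0, -1} then h i else 0)" for i
    unfolding eq by (rule pmf_embed_finite_support) (use assms in \<open>auto simp: h_def\<close>)
  have "pmf (bind_pmf (choice_pmf a b c) f) x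
      = (\<Sum>i\<in>{1, 0, -1}. pmf (f i) x * pmf (choice_pmf a b c) i)"
    unfolding pmf_bind
    by (rule integral_measure_pmf_real) (auto simp: set_pmf_iff pmf split: if_splits)
  then show ?thesis by (simp add: pmf h_def)
qed

text \<open>
  Invariance of \<open>\<rho>\<close> is detailed balance summed over one argument. For another invariant \<open>\<rho>'\<close>, detailed
  balance makes the density \<open>h = \<rho>' / \<rho>\<close> harmonic: \<open>h t\<close> is the average of \<open>h\<close> under
  \<open>K t\<close>. Where \<open>h\<close> attains its maximum, all states reachable in one step attain it as well, so by
  irreducibility \<open>h\<close> is constant, and the constant is 1 since both are probability distributions.
\<close>

lemma invariant_pmf_iff_reversible:
  fixes K :: "'s \<Rightarrow> 's pmf" and \<rho> \<rho>' :: "'s pmf"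
  assumes fin: "finite S" and closed: "\<And>s. s \<in> S \<Longrightarrow> set_pmf (K s) \<subseteq> S"
    and rev: "reversible_wrt S K \<rho>" and supp: "set_pmf \<rho> = S"
    and irr: "\<And>s t. s \<in> S \<Longrightarrow> t \<in> S \<Longrightarrow> (\<lambda>x y. y \<in> S \<and> pmf (K x) y > 0)\<^sup>*\<^sup>* s t"
  shows "invariant_pmf S K \<rho>' \<longleftrightarrow> \<rho>' = \<rho>"
proof -
  have bind: "pmf (bind_pmf \<mu> K) t = (\<Sum>s\<in>S. pmf \<mu> s * pmf (K s) t)" if "set_pmf \<mu> \<subseteq> S" for \<mu> t
    unfolding pmf_bind
    using that fin by (subst integral_measure_pmf_real[of S]) (auto simp: mult.commute)
  have row: "(\<Sum>t\<in>S. pmf (K s) t) = 1" if "s \<in> S" for s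
    using fin closed[OF that] by (rule sum_pmf_eq_1)
  have db: "pmf \<rho> s * pmf (K s) t = pmf \<rho> t * pmf (K t) s" if "s \<in> S" "t \<in> S" for s t
    using rev that by (simp add: reversible_wrt_def)
  have pos: "pmf \<rho> t > 0" if "t \<in> S" for t
    using supp that by (simp add: pmf_positive)
  have out: "pmf \<mu> t = 0" if "set_pmf \<mu> \<subseteq> S" "t \<notin> S" for \<mu> t
    using that by (auto simp: set_pmf_iff)
  have inv: "bind_pmf \<rho> K = \<rho>"
  proof (rule pmf_eqI)
    fix t
    show "pmf (bind_pmf \<rho> K) t = pmf \<rho> t"
    proof (cases "t \<in> S")
      case True
      have "(\<Sum>s\<in>S. pmf \<rho> s * pmf (K s) t) = (\<Sum>s\<in>S. pmf \<rho> t * pmf (K t) s)"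
        using db True by (intro sum.cong) auto
      also have "\<dots> = pmf \<rho> t" using row[OF True] by (simp add: sum_distrib_left[symmetric])
      finally show ?thesis using bind[of \<rho> t] supp by simp
    next
      case False
      have "(\<Sum>s\<in>S. pmf \<rho> s * pmf (K s) t) = 0"
        using out[OF closed False] by (intro sum.neutral) auto
      then show ?thesis using bind[of \<rho> t] out[of \<rho> t] supp False by simp
    qed
  qed
  show ?thesis
  proof
    assume "invariant_pmf S K \<rho>'"
    then have sub: "set_pmf \<rho>' \<subseteq> S" and inv': "bind_pmf \<rho>' K = \<rho>'" by (auto simp: invariant_pmf_def)
    define h where "h t = pmf \<rho>' t / pmf \<rho> t" for t
    have \<rho>': "pmf \<rho>' t = pmf \<rho> t * h t" if "t \<in> S" for t
      using pos[OF that] by (simp add: h_def)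
    have harmonic: "(\<Sum>s\<in>S. pmf (K t) s * h s) = h t" if t: "t \<in> S" for t
    proof -
      have "pmf \<rho> t * (\<Sum>s\<in>S. pmf (K t) s * h s) = (\<Sum>s\<in>S. pmf \<rho>' s * pmf (K s) t)"
        unfolding sum_distrib_left
      proof (rule sum.cong)
        fix s assume s: "s \<in> S"
        have "pmf \<rho> t * (pmf (K t) s * h s) = (pmf \<rho> s * pmf (K s) t) * h s"
          unfolding db[OF s t] by simp
        then show "pmf \<rho> t * (pmf (K t) s * h s) = pmf \<rho>' s * pmf (K s) t"
          unfolding \<rho>'[OF s] by simp
      qed simp
      also have "\<dots> = pmf \<rho> t * h t" using bind[OF sub, of t] inv' \<rho>'[OF t] by simp
      finally show ?thesis using pos[OF t] by simp
    qed
    have "S \<noteq> {}" using supp set_pmf_not_empty[of \<rho>] by simp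
    then have "Max (h ` S) \<in> h ` S" using fin by (intro Max_in) auto
    then obtain t0 where t0: "t0 \<in> S" "h t0 = Max (h ` S)" by (metis imageE)
    have le: "h s \<le> h t0" if "s \<in> S" for s using t0 that fin by simp
    have const: "h t = h t0" if "t \<in> S" for t
      using irr[OF t0(1) that]
    proof (induction rule: rtranclp_induct)
      case (step t s)
      have t: "t \<in> S" using step.hyps(1) t0(1) by (induction rule: rtranclp_induct) auto
      have "(\<Sum>s\<in>S. pmf (K t) s * (h t0 - h s)) = (\<Sum>s\<in>S. pmf (K t) s) * h t0 - (\<Sum>s\<in>S. pmf (K t) s * h s)"
        by (simp add: right_diff_distrib sum_subtractf sum_distrib_right)
      also have "\<dots> = 0" using row[OF t] harmonic[OF t] step.IH by simp
      finally have "\<forall>s\<in>S. pmf (K t) s * (h t0 - h s) = 0"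
        using fin le by (subst (asm) sum_nonneg_eq_0_iff) auto
      then show ?case using step.hyps(2) by auto
    qed simp
    have "1 = (\<Sum>t\<in>S. pmf \<rho>' t)" using fin sub by (rule sum_pmf_eq_1[symmetric])
    also have "\<dots> = (\<Sum>t\<in>S. pmf \<rho> t * h t0)" using \<rho>' const by (intro sum.cong) auto
    also have "\<dots> = h t0" using sum_pmf_eq_1[OF fin, of \<rho>] supp by (simp add: sum_distrib_right[symmetric])
    finally have h1: "h t0 = 1" by simp
    show "\<rho>' = \<rho>"
    proof (rule pmf_eqI)
      fix t show "pmf \<rho>' t = pmf \<rho> t"
        using \<rho>'[of t] const[of t] h1 out[OF sub, of t] out[of \<rho> t] supp by (cases "t \<in> S") auto
    qed
  next
    assume "\<rho>' = \<rho>"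
    then show "invariant_pmf S K \<rho>'" using inv supp by (simp add: invariant_pmf_def)
  qed
qed

section \<open>The kernel as a sum over darts\<close>

locale regular_subtree_chain =
  fixes G :: "'a ugraph" and p q r :: "nat \<Rightarrow> real" and d :: nat
  assumes fsg: "finite_simple_graph G"
    and conn: "connected_graph G"
    and two_verts: "num_verts G \<ge> 2"
    and regular: "v \<in> verts G \<Longrightarrow> vertex_degree G v = d"
    and probs: "i \<in> {1..num_verts G} \<Longrightarrow> p i \<ge> 0 \<and> q i \<ge> 0 \<and> r i \<ge> 0 \<and> p i + q i + r i = 1"
    and r_pos: "i \<in> {2..num_verts G} \<Longrightarrow> r i > 0"
    and p_pos: "i \<in> {1..num_verts G - 1} \<Longrightarrow> p i > 0"
begin

abbreviation K :: "'a ugraph \<Rightarrow> 'a ugraph pmf" where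
  "K \<equiv> subtree_kernel G p q r"

lemma finite_verts: "finite (verts G)"
  using fsg by (simp add: finite_simple_graph_def)

lemma subtreeD:
  assumes "t \<in> subtrees G"
  shows "finite_simple_graph t" "connected_graph t" "card (edges t) + 1 = num_verts t"
    "verts t \<subseteq> verts G" "edges t \<subseteq> edges G" "finite (verts t)" "verts t \<noteq> {}" "finite (edges t)"
    "num_verts t \<in> {1..num_verts G}"
proof -
  show *: "finite_simple_graph t" "connected_graph t" "card (edges t) + 1 = num_verts t"
    "verts t \<subseteq> verts G" "edges t \<subseteq> edges G"
    using assms by (auto simp: subtrees_iff subgraph_def tree_iff_edge_count)
  then show "finite (verts t)" "verts t \<noteq> {}"
    by (auto simp: finite_simple_graph_def connected_graph_def)
  show "finite (edges t)" using * by (intro finite_edges)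
  have "num_verts t \<ge> 1" using * by linarith
  then show "num_verts t \<in> {1..num_verts G}" using card_mono[OF finite_verts, of "verts t"] * by simp
qed

lemma neighbours_G:
  assumes "v \<in> verts G"
  shows "finite (neighbours G v)" "neighbours G v \<noteq> {}" "card (neighbours G v) = d" "d > 0"
proof -
  have "neighbours G v \<subseteq> verts G"
    using edge_endpoints[OF fsg] by (auto simp: neighbours_def)
  then show fin: "finite (neighbours G v)" using finite_verts finite_subset by blast
  show card: "card (neighbours G v) = d" using regular[OF assms] by (simp add: vertex_degree_def)
  have "verts G \<noteq> {v}" using two_verts by auto
  then show "neighbours G v \<noteq> {}"
    using crossing_edge[OF fsg conn, of "UGraph {v} {}"] assms by (auto simp: neighbours_def)
  with fin card show "d > 0" by (auto simp: card_gt_0_iff)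
qed

lemma d_pos: "d > 0"
proof -
  have "verts G \<noteq> {}" using two_verts by auto
  then show ?thesis using neighbours_G(4) by blast
qed

text \<open>
  The oriented edges that the kernel can pick from \<open>t\<close>; their heads may lie outside \<open>t\<close>.
\<close>

definition darts :: "'a ugraph \<Rightarrow> ('a \<times> 'a) set" where
  "darts t = Sigma (verts t) (neighbours G)"

lemma dartsD:
  assumes "t \<in> subtrees G" "(u, w) \<in> darts t"
  shows "u \<in> verts t" "{u, w} \<in> edges G" "w \<in> verts G" "u \<noteq> w"
  using assms edge_endpoints[OF fsg, of u w] by (auto simp: darts_def neighbours_def)

lemma finite_darts: "t \<in> subtrees G \<Longrightarrow> finite (darts t)"
  using subtreeD[of t] neighbours_G(1) unfolding darts_def by (intro finite_SigmaI) auto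

definition add_step :: "'a ugraph \<Rightarrow> 'a set \<Rightarrow> 'a ugraph pmf" where
  "add_step t e = (let g = add_edge t e in
     if tree g then return_pmf g
     else map_pmf (delete_edge g) (cycle_pmf G (SOME c. simple_cycle g c)))"

text \<open>
  Regularity makes the vertex and the neighbour jointly uniform on the darts.
\<close>

lemma kernel_pmf:
  assumes t: "t \<in> subtrees G"
  defines "n \<equiv> num_verts t"
  shows "pmf (K t) s = (\<Sum>(u, w)\<in>darts t.
           p n * pmf (add_step t {u, w}) s + q n * pmf (return_pmf t) s
             + r n * pmf (return_pmf (remove_edge t (u, w))) s) / (real n * real d)"
proof -
  let ?f = "\<lambda>u w. p n * pmf (add_step t {u, w}) s + q n * pmf (return_pmf t) s
             + r n * pmf (return_pmf (remove_edge t (u, w))) s"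
  note D = subtreeD[OF t]
  have "n \<in> {1..num_verts G}" using D by (simp add: n_def)
  note pn = probs[OF this]
  define row where "row u w = bind_pmf (choice_pmf (p n) (q n) (r n)) (\<lambda>c.
      if c = 1 then add_step t {u, w} else if c = 0 then return_pmf t
      else return_pmf (remove_edge t (u, w)))" for u w
  have K: "K t = bind_pmf (pmf_of_set (verts t)) (\<lambda>u. bind_pmf (pmf_of_set (neighbours G u)) (row u))"
    unfolding subtree_kernel_def row_def add_step_def n_def ..
  have row: "pmf (row u w) s = ?f u w" for u w
    unfolding row_def using pn by (subst pmf_bind_choice_pmf) auto
  have "pmf (K t) s = (\<Sum>u\<in>verts t. pmf (bind_pmf (pmf_of_set (neighbours G u)) (row u)) s) / real n"
    unfolding K n_def using D by (intro pmf_bind_pmf_of_set)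
  also have "\<dots> = (\<Sum>u\<in>verts t. (\<Sum>w\<in>neighbours G u. ?f u w) / real d) / real n"
  proof (intro arg_cong[of _ _ "\<lambda>x. x / real n"] sum.cong refl)
    fix u assume "u \<in> verts t"
    then have "u \<in> verts G" using D by blast
    note N = neighbours_G[OF this]
    show "pmf (bind_pmf (pmf_of_set (neighbours G u)) (row u)) s = (\<Sum>w\<in>neighbours G u. ?f u w) / real d"
      unfolding pmf_bind_pmf_of_set[OF N(2,1)] row N(3) ..
  qed
  also have "\<dots> = (\<Sum>u\<in>verts t. \<Sum>w\<in>neighbours G u. ?f u w) / (real n * real d)"
    by (simp add: sum_divide_distrib[symmetric] mult.commute)
  also have "(\<Sum>u\<in>verts t. \<Sum>w\<in>neighbours G u. ?f u w) = (\<Sum>(u, w)\<in>darts t. ?f u w)"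
    unfolding darts_def using D neighbours_G(1) by (intro sum.Sigma) auto
  finally show ?thesis .
qed

lemma kernel_off_diagonal:
  assumes t: "t \<in> subtrees G" and "s \<noteq> t"
  defines "n \<equiv> num_verts t"
  shows "pmf (K t) s = (p n * (\<Sum>(u, w)\<in>darts t. pmf (add_step t {u, w}) s)
           + r n * real (card {x \<in> darts t. remove_edge t x = s})) / (real n * real d)"
proof -
  have "(\<Sum>x\<in>darts t. pmf (return_pmf (remove_edge t x)) s)
      = (\<Sum>x\<in>darts t. if remove_edge t x = s then 1 else 0)"
    by (intro sum.cong) (auto simp: pmf_return)
  also have "\<dots> = real (card {x \<in> darts t. remove_edge t x = s})"
    using finite_darts[OF t] by (simp add: sum.If_cases Collect_conj_eq[symmetric] Int_def)
  finally have R: "(\<Sum>x\<in>darts t. pmf (return_pmf (remove_edge t x)) s) = \<dots>" .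
  have "pmf (return_pmf t) s = 0" using assms(2) by (simp add: pmf_return)
  then have "pmf (K t) s = (\<Sum>x\<in>darts t. p n * (case x of (u, w) \<Rightarrow> pmf (add_step t {u, w}) s)
             + r n * pmf (return_pmf (remove_edge t x)) s) / (real n * real d)"
    unfolding kernel_pmf[OF t] n_def by (auto intro!: arg_cong[of _ _ "\<lambda>x. x / _"] sum.cong)
  then show ?thesis by (simp only: sum.distrib sum_distrib_left[symmetric] R)
qed

section \<open>Adding an edge\<close>

lemma attach_leaf_subtree:
  assumes "t \<in> subtrees G" "(u, w) \<in> darts t" "w \<notin> verts t"
  shows "attach_leaf t u w \<in> subtrees G"
  using assms dartsD[OF assms(1,2)] subtreeD[OF assms(1)] tree_attach_leaf[of t u w]
  by (auto simp: subtrees_iff subgraph_def)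

lemma subtree_eqI:
  assumes "s \<in> subtrees G" "t \<in> subtrees G" "num_verts s = num_verts t" "edges s \<subseteq> edges t"
    and "verts s = verts t"
  shows "s = t"
proof -
  have "card (edges s) = card (edges t)" using subtreeD(3)[OF assms(1)] subtreeD(3)[OF assms(2)] assms(3) by simp
  then have "edges s = edges t" using subtreeD(8)[OF assms(2)] assms(4) by (intro card_subset_eq)
  with assms(5) show ?thesis by (rule ugraph_eqI)
qed

lemma edges_eq_imp_eq:
  assumes "s \<in> subtrees G" "t \<in> subtrees G" "edges s = edges t" "edges s \<noteq> {}"
  shows "s = t"
  using assms graph_of_edges_tree[of s] graph_of_edges_tree[of t] by (metis subtrees_iff)

text \<open>
  The outcome of \<open>add_edge\<close> for a new edge with both endpoints in \<open>t\<close>.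
\<close>

definition add_chord :: "'a ugraph \<Rightarrow> 'a set \<Rightarrow> 'a ugraph" where
  "add_chord t e = UGraph (verts t) (insert e (edges t))"

text \<open>
  \<open>add_edge\<close> rebuilds the vertex set from the edges. This loses no vertex: isolated vertices occur only in the
  tree with a single vertex, and there the new edge covers that vertex.
\<close>

lemma add_edge_cases:
  assumes t: "t \<in> subtrees G" and uw: "(u, w) \<in> darts t"
  shows add_edge_leaf: "w \<notin> verts t \<Longrightarrow> add_edge t {u, w} = attach_leaf t u w"
    and add_edge_present: "{u, w} \<in> edges t \<Longrightarrow> add_edge t {u, w} = t"
    and add_edge_chord: "w \<in> verts t \<Longrightarrow> {u, w} \<notin> edges t \<Longrightarrow> add_edge t {u, w} = add_chord t {u, w}"
proof -
  note U = dartsD[OF t uw]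
  have g: "add_edge t {u, w} = graph_of_edges (insert {u, w} (edges t))"
    using U by (simp add: add_edge_def)
  show "add_edge t {u, w} = attach_leaf t u w" if "w \<notin> verts t"
    using graph_of_edges_tree[of "attach_leaf t u w"] attach_leaf_subtree[OF t uw that] g
    by (simp add: subtrees_iff)
  have tE: "graph_of_edges (edges t) = t" if "edges t \<noteq> {}"
    using graph_of_edges_tree[of t] t that by (simp add: subtrees_iff)
  show "add_edge t {u, w} = t" if "{u, w} \<in> edges t"
    using tE that by (auto simp: g insert_absorb)
  show "add_edge t {u, w} = add_chord t {u, w}" if w: "w \<in> verts t"
  proof -
    have "card {u, w} \<le> num_verts t" using w U subtreeD(6)[OF t] by (intro card_mono) auto
    then have "card (edges t) \<noteq> 0" using U(4) subtreeD(3)[OF t] by simp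
    then have "\<Union>(edges t) = verts t" using tE by (metis card.empty graph_of_edges_def ugraph.sel(1))
    then show ?thesis using w U by (auto simp: g graph_of_edges_def add_chord_def)
  qed
qed

text \<open>
  The new edge brings the number of edges up to the number of vertices, so the graph is no
  longer a tree, and being connected it must contain a cycle.
\<close>

lemma add_chord_props:
  assumes t: "t \<in> subtrees G" and uw: "(u, w) \<in> darts t" and w: "w \<in> verts t" "{u, w} \<notin> edges t"
  defines "g \<equiv> add_chord t {u, w}"
  shows "finite_simple_graph g" "connected_graph g" "\<not> tree g" "subgraph g G" "\<exists>c. simple_cycle g c"
    and "card (edges g) = num_verts g"
proof -
  note U = dartsD[OF t uw] and D = subtreeD[OF t]
  show 1: "finite_simple_graph g"
    using U D(1) w by (auto simp: g_def add_chord_def finite_simple_graph_def)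
  show 2: "connected_graph g"
    using D(2) unfolding connected_graph_iff_reach
    by (auto simp: g_def add_chord_def intro: reach_mono[of t])
  show 3: "card (edges g) = num_verts g" using D(3,8) w by (simp add: g_def add_chord_def)
  then show 4: "\<not> tree g" by (simp add: tree_iff_edge_count)
  show "\<exists>c. simple_cycle g c" using 1 2 4 by (auto simp: tree_def)
  show "subgraph g G" using D U by (auto simp: g_def add_chord_def subgraph_def)
qed

text \<open>
  Otherwise the cycle would already live in \<open>s\<close>. This applies to both trees of a cycle move
  and places the added edge and the deleted edge on the same cycle, whichever cycle of \<open>g\<close> is
  chosen.
\<close>

lemma chord_on_cycle:
  assumes s: "tree s" and g: "verts g = verts s" "edges g \<subseteq> insert e (edges s)" and c: "simple_cycle g c"
  shows "e \<in> cycle_edges c"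
proof (rule ccontr)
  assume "e \<notin> cycle_edges c"
  with c g have "simple_cycle s c" by (auto simp: simple_cycle_def)
  with s show False by (auto simp: tree_def)
qed

text \<open>
  Deleting the edge keeps the graph connected and restores the edge count of a tree.
\<close>

lemma delete_cycle_edge_subtree:
  assumes g: "finite_simple_graph g" "connected_graph g" "subgraph g G" "card (edges g) = num_verts g"
    and c: "simple_cycle g c" and e: "e \<in> cycle_edges c"
  shows "delete_edge g e \<in> subtrees G" "num_verts (delete_edge g e) = num_verts g"
proof -
  have e': "e \<in> edges g" using c e by (auto simp: simple_cycle_def)
  have "card (edges (delete_edge g e)) + 1 = num_verts (delete_edge g e)"
    using card_Suc_Diff1[OF finite_edges[OF g(1)] e'] g(4) by (simp add: delete_edge_def del: card_Diff_insert)
  then have "tree (delete_edge g e)"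
    using delete_edge_fsg[OF g(1)] delete_cycle_edge_connected[OF g(2) c e] by (simp add: tree_iff_edge_count)
  then show "delete_edge g e \<in> subtrees G"
    using g(3) by (auto simp: subtrees_iff subgraph_def delete_edge_def)
qed (simp add: delete_edge_def)

text \<open>
  In a regular graph all edges have the same weight, so the deleted edge is uniform on the cycle. The
  symmetry of the cycle moves depends on this.
\<close>

lemma cycle_pmf_uniform:
  assumes c: "simple_cycle g c" and g: "subgraph g G"
  shows "cycle_pmf G c = pmf_of_set (cycle_edges c)" "finite (cycle_edges c)" "cycle_edges c \<noteq> {}"
proof -
  let ?C = "cycle_edges c"
  have "length c > 0" using c by (auto simp: simple_cycle_def)
  then show C: "finite ?C" "?C \<noteq> {}" by (auto simp: cycle_edges_def)
  then have pos: "card ?C > 0" by (simp add: card_gt_0_iff)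
  have sub: "?C \<subseteq> edges G" using c g by (auto simp: simple_cycle_def subgraph_def)
  have wt: "cycle_weight G e = 2 / real d" if "e \<in> ?C" for e
  proof -
    have "e \<subseteq> verts G" "card e = 2" using that sub fsg by (auto simp: finite_simple_graph_def)
    then have "cycle_weight G e = (\<Sum>v\<in>e. 1 / real d)"
      unfolding cycle_weight_def using regular by (intro sum.cong) auto
    then show ?thesis using \<open>card e = 2\<close> by simp
  qed
  have total: "(\<Sum>e\<in>?C. cycle_weight G e) = real (card ?C) * (2 / real d)" using wt by simp
  have *: "pmf (cycle_pmf G c) e = (if e \<in> ?C then cycle_weight G e / (\<Sum>e\<in>?C. cycle_weight G e) else 0)" for e
    unfolding cycle_pmf_def
  proof (rule pmf_embed_finite_support[OF C(1)])
    show "(\<Sum>e\<in>?C. cycle_weight G e / (\<Sum>e\<in>?C. cycle_weight G e)) = 1"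
      unfolding sum_divide_distrib[symmetric] using pos d_pos by (simp add: total)
  qed (simp add: cycle_weight_def sum_nonneg)
  show "cycle_pmf G c = pmf_of_set ?C"
  proof (rule pmf_eqI)
    fix e show "pmf (cycle_pmf G c) e = pmf (pmf_of_set ?C) e"
      using C pos d_pos by (simp add: * total wt indicator_def)
  qed
qed

lemma add_step_cases:
  assumes t: "t \<in> subtrees G" and uw: "(u, w) \<in> darts t"
  shows add_step_leaf: "w \<notin> verts t \<Longrightarrow> add_step t {u, w} = return_pmf (attach_leaf t u w)"
    and add_step_present: "{u, w} \<in> edges t \<Longrightarrow> add_step t {u, w} = return_pmf t"
    and add_step_chord: "w \<in> verts t \<Longrightarrow> {u, w} \<notin> edges t \<Longrightarrow>
      add_step t {u, w} = map_pmf (delete_edge (add_chord t {u, w}))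
        (pmf_of_set (cycle_edges (SOME c. simple_cycle (add_chord t {u, w}) c)))"
proof -
  show "add_step t {u, w} = return_pmf (attach_leaf t u w)" if "w \<notin> verts t"
    using add_edge_leaf[OF t uw that] attach_leaf_subtree[OF t uw that]
    by (simp add: add_step_def subtrees_iff)
  show "add_step t {u, w} = return_pmf t" if "{u, w} \<in> edges t"
    using add_edge_present[OF t uw that] t by (simp add: add_step_def subtrees_iff)
  show "add_step t {u, w} = map_pmf (delete_edge (add_chord t {u, w}))
        (pmf_of_set (cycle_edges (SOME c. simple_cycle (add_chord t {u, w}) c)))"
    if w: "w \<in> verts t" "{u, w} \<notin> edges t"
  proof -
    note g = add_chord_props[OF t uw w]
    show ?thesis
      using add_edge_chord[OF t uw w] g(3) cycle_pmf_uniform(1)[OF someI_ex[OF g(5)] g(4)]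
      by (simp add: add_step_def Let_def)
  qed
qed

lemma set_add_step_chord:
  assumes t: "t \<in> subtrees G" and uw: "(u, w) \<in> darts t" and w: "w \<in> verts t" "{u, w} \<notin> edges t"
    and s: "s \<in> set_pmf (add_step t {u, w})"
  shows "s \<in> subtrees G" "verts s = verts t"
proof -
  note g = add_chord_props[OF t uw w]
  note c = someI_ex[OF g(5)]
  obtain e where e: "e \<in> cycle_edges (SOME c. simple_cycle (add_chord t {u, w}) c)"
      "s = delete_edge (add_chord t {u, w}) e"
    using s cycle_pmf_uniform(2,3)[OF c g(4)] by (auto simp: add_step_chord[OF t uw w])
  show "s \<in> subtrees G" "verts s = verts t"
    using delete_cycle_edge_subtree(1)[OF g(1,2,4,6) c e(1)] e(2)
    by (simp_all add: delete_edge_def add_chord_def)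
qed

lemma set_add_step:
  assumes t: "t \<in> subtrees G" and uw: "(u, w) \<in> darts t" and s: "s \<in> set_pmf (add_step t {u, w})"
  shows "s \<in> subtrees G"
proof -
  consider "w \<notin> verts t" | "{u, w} \<in> edges t" | "w \<in> verts t" "{u, w} \<notin> edges t" by blast
  then show ?thesis
  proof cases
    case 1 then show ?thesis using s attach_leaf_subtree[OF t uw] by (simp add: add_step_leaf[OF t uw])
  next
    case 2 then show ?thesis using s t by (simp add: add_step_present[OF t uw])
  next
    case 3 then show ?thesis using s set_add_step_chord[OF t uw] by blast
  qed
qed

section \<open>Removing an edge and attaching a leaf\<close>

lemma remove_edge_subtree:
  assumes t: "t \<in> subtrees G" and uw: "(u, w) \<in> darts t"
  shows "remove_edge t (u, w) \<in> subtrees G"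
proof -
  note D = subtreeD[OF t] and U = dartsD[OF t uw]
  have "tree (UGraph {u} {})"
    by (auto simp: tree_iff_edge_count finite_simple_graph_def connected_graph_def)
  then have 1: "UGraph {u} {} \<in> subtrees G" using U D by (auto simp: subtrees_iff subgraph_def)
  have 2: "graph_of_edges (edges t - {e}) \<in> subtrees G" if "tree (graph_of_edges (edges t - {e}))" for e
    using that D(1,4,5) by (auto simp: subtrees_iff subgraph_def graph_of_edges_def finite_simple_graph_def)
  show ?thesis using 1 2 t by (simp add: remove_edge_def Let_def)
qed

lemma kernel_closed:
  assumes t: "t \<in> subtrees G"
  shows "set_pmf (K t) \<subseteq> subtrees G"
proof
  fix s assume s: "s \<in> set_pmf (K t)"
  define f where "f u w = p (num_verts t) * pmf (add_step t {u, w}) s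
      + q (num_verts t) * pmf (return_pmf t) s
      + r (num_verts t) * pmf (return_pmf (remove_edge t (u, w))) s" for u w
  have "pmf (K t) s \<noteq> 0" using s by (simp add: set_pmf_iff)
  then have "(\<Sum>(u, w)\<in>darts t. f u w) \<noteq> 0"
    unfolding kernel_pmf[OF t] f_def[symmetric] by auto
  then obtain u w where uw: "(u, w) \<in> darts t" and "f u w \<noteq> 0"
    by (rule sum.not_neutral_contains_not_neutral) auto
  then have "s \<in> set_pmf (add_step t {u, w}) \<or> s = t \<or> s = remove_edge t (u, w)"
    by (auto simp: f_def set_pmf_iff indicator_def split: if_splits)
  then show "s \<in> subtrees G"
    using set_add_step[OF t uw] t remove_edge_subtree[OF t uw] by blast
qed

text \<open>
  The darts along which a leaf is attached to \<open>t\<close> to give \<open>s\<close>. Their number governs both the move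
  from \<open>t\<close> to \<open>s\<close> and its reversal.
\<close>

definition leaf_darts :: "'a ugraph \<Rightarrow> 'a ugraph \<Rightarrow> ('a \<times> 'a) set" where
  "leaf_darts t s = {(u, w) \<in> darts t. w \<notin> verts t \<and> s = attach_leaf t u w}"

lemma leaf_darts_num_verts:
  assumes "t \<in> subtrees G" "leaf_darts t s \<noteq> {}"
  shows "num_verts s = Suc (num_verts t)"
  using assms attach_leaf_card(1)[OF subtreeD(1)[OF assms(1)]] by (auto simp: leaf_darts_def)

text \<open>
  Adding an edge between two vertices of \<open>t\<close> leaves the order unchanged, so only leaves contribute.
\<close>

lemma add_prob_other_size:
  assumes t: "t \<in> subtrees G" and ne: "num_verts s \<noteq> num_verts t"
  shows "(\<Sum>(u, w)\<in>darts t. pmf (add_step t {u, w}) s) = real (card (leaf_darts t s))"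
proof -
  have *: "pmf (add_step t {u, w}) s = (if (u, w) \<in> leaf_darts t s then 1 else 0)"
    if uw: "(u, w) \<in> darts t" for u w
  proof -
    consider "w \<notin> verts t" | "{u, w} \<in> edges t" "w \<in> verts t" | "w \<in> verts t" "{u, w} \<notin> edges t" by blast
    then show ?thesis
    proof cases
      case 1 then show ?thesis using uw by (simp add: add_step_leaf[OF t uw] leaf_darts_def pmf_return)
    next
      case 2 then show ?thesis using ne by (auto simp: add_step_present[OF t uw] leaf_darts_def indicator_def)
    next
      case 3
      then have "s \<notin> set_pmf (add_step t {u, w})" using set_add_step_chord[OF t uw, of s] ne by auto
      then show ?thesis using 3 by (simp add: set_pmf_iff leaf_darts_def)
    qed
  qed
  have "(\<Sum>(u, w)\<in>darts t. pmf (add_step t {u, w}) s) = (\<Sum>x\<in>darts t. if x \<in> leaf_darts t s then 1 else 0)"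
    using * by (intro sum.cong) auto
  also have "\<dots> = real (card (darts t \<inter> leaf_darts t s))"
    using finite_darts[OF t] by (simp add: sum.If_cases Int_def)
  also have "darts t \<inter> leaf_darts t s = leaf_darts t s" by (auto simp: leaf_darts_def)
  finally show ?thesis .
qed

text \<open>
  Removing an edge of \<open>s\<close> gives \<open>t\<close> only if the edge joins a leaf of \<open>s\<close> to \<open>t\<close>. Both
  orientations of this edge have the same effect, unless \<open>t\<close> is a single vertex: then the tail of
  the dart is the vertex that is kept, and only one orientation leads to \<open>t\<close>.
\<close>

lemma remove_edge_darts:
  assumes t: "t \<in> subtrees G" and s: "s \<in> subtrees G" and ne: "s \<noteq> t"
  shows "{x \<in> darts s. remove_edge s x = t}
       = leaf_darts t s \<union> (if num_verts t = 1 then {} else prod.swap ` leaf_darts t s)"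
    (is "?R = ?L")
proof (rule set_eqI, clarify)
  note T = subtreeD[OF t] and S = subtreeD[OF s]
  fix v v' :: 'a
  let ?e = "{v, v'}"
  show "(v, v') \<in> ?R \<longleftrightarrow> (v, v') \<in> ?L"
  proof
    assume R: "(v, v') \<in> ?R"
    then have vv: "(v, v') \<in> darts s" and rem: "remove_edge s (v, v') = t" by auto
    note U = dartsD[OF s vv]
    have "t = (if edges s = {?e} then UGraph {v} {}
        else if card (edges s) > 1 \<and> tree (graph_of_edges (edges s - {?e}))
          then graph_of_edges (edges s - {?e}) else s)"
      unfolding rem[symmetric] remove_edge_def by (simp only: Let_def case_prod_conv)
    then consider "edges s = {?e}" "t = UGraph {v} {}"
      | "edges s \<noteq> {?e}" "card (edges s) > 1" "t = graph_of_edges (edges s - {?e})"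
      using ne by metis
    then show "(v, v') \<in> ?L"
    proof cases
      case 1
      have "graph_of_edges (edges s) = s" using graph_of_edges_tree[of s] s 1 by (auto simp: subtrees_iff)
      then have "s = attach_leaf t v v'" using 1 by (auto simp: graph_of_edges_def attach_leaf_def)
      then show ?thesis using 1 vv U by (auto simp: leaf_darts_def darts_def)
    next
      case 2
      have Et: "edges t = edges s - {?e}" using 2 by (simp add: graph_of_edges_def)
      have e: "?e \<in> edges s"
      proof (rule ccontr)
        assume "?e \<notin> edges s"
        then have "edges t = edges s" using Et by simp
        moreover have "edges s \<noteq> {}" using 2(2) by auto
        ultimately show False using edges_eq_imp_eq[OF s t] ne by simp
      qed
      have "graph_of_edges (edges s) = s" using graph_of_edges_tree[of s] s e by (auto simp: subtrees_iff)
      then have Vs: "verts s = \<Union>(edges s)" by (metis graph_of_edges_def ugraph.sel(1))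
      have Vt: "verts t = \<Union>(edges t)" using 2 by (simp add: graph_of_edges_def)
      have V: "verts s = verts t \<union> {v, v'}" using Vs Vt Et e by auto
      have "card (edges s) = Suc (card (edges t))" using card_Suc_Diff1[OF S(8) e] Et by simp
      then have num: "num_verts s = Suc (num_verts t)" using S(3) T(3) by simp
      have two: "num_verts t \<noteq> 1" using 2 num S(3) by simp
      have "v \<notin> verts t \<and> v' \<in> verts t \<or> v \<in> verts t \<and> v' \<notin> verts t"
        using V num T(6) U(4) by (cases "v \<in> verts t"; cases "v' \<in> verts t") (auto simp: insert_absorb)
      then show ?thesis
      proof
        assume *: "v \<notin> verts t \<and> v' \<in> verts t"
        then have "s = attach_leaf t v' v" using V Et e
          by (intro ugraph_eqI) (auto simp: attach_leaf_def insert_commute)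
        then have "(v', v) \<in> leaf_darts t s"
          using * U by (auto simp: leaf_darts_def darts_def neighbours_def insert_commute)
        then show ?thesis using two by force
      next
        assume *: "v \<in> verts t \<and> v' \<notin> verts t"
        then have "s = attach_leaf t v v'" using V Et e
          by (intro ugraph_eqI) (auto simp: attach_leaf_def insert_commute)
        then show ?thesis
          using * U by (auto simp: leaf_darts_def darts_def neighbours_def)
      qed
    qed
  next
    assume "(v, v') \<in> ?L"
    then consider (fwd) "(v, v') \<in> leaf_darts t s" | (bwd) "(v', v) \<in> leaf_darts t s" "num_verts t \<noteq> 1"
      by (auto split: if_splits)
    then obtain a b where ab: "(a, b) \<in> leaf_darts t s" "?e = {a, b}"
      and dir: "num_verts t = 1 \<Longrightarrow> v = a"
      by cases (auto simp: insert_commute)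
    then have b: "b \<notin> verts t" "s = attach_leaf t a b" and a: "(a, b) \<in> darts t" by (auto simp: leaf_darts_def)
    note A = dartsD[OF t a]
    have e: "?e \<notin> edges t" using edge_endpoints(2)[OF T(1), of a b] b ab by auto
    have Es: "edges s = insert ?e (edges t)" using b ab by simp
    have diff: "edges s - {?e} = edges t" using Es e by auto
    have dart: "(v, v') \<in> darts s"
      using A b ab by (auto simp: darts_def neighbours_def doubleton_eq_iff insert_commute)
    have "remove_edge s (v, v') = t"
    proof (cases "num_verts t = 1")
      case True
      then have "edges t = {}" using T(3,8) by simp
      moreover have "verts t = {v}" using True A(1) dir by (metis card_1_singletonE singletonD)
      ultimately show ?thesis using Es by (cases t) (simp add: remove_edge_def Let_def)
    next
      case False
      then have "card (edges t) > 0" using T(3) by linarith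
      then have ne: "edges t \<noteq> {}" "card (edges s) > 1" using Es e T(8) by auto
      then have "graph_of_edges (edges t) = t" using graph_of_edges_tree[of t] t by (simp add: subtrees_iff)
      moreover have "edges s \<noteq> {?e}" using ne by auto
      ultimately show ?thesis using ne t by (simp add: remove_edge_def Let_def diff subtrees_iff)
    qed
    with dart show "(v, v') \<in> ?R" by simp
  qed
qed

lemma card_remove_edge_darts:
  assumes t: "t \<in> subtrees G" and s: "s \<in> subtrees G" and ne: "s \<noteq> t"
  shows "card {x \<in> darts s. remove_edge s x = t}
       = (if num_verts t = 1 then 1 else 2) * card (leaf_darts t s)"
proof -
  have fin: "finite (leaf_darts t s)"
    using finite_darts[OF t] by (rule finite_subset[rotated]) (auto simp: leaf_darts_def)
  have disj: "leaf_darts t s \<inter> prod.swap ` leaf_darts t s = {}"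
    by (auto simp: leaf_darts_def darts_def)
  have "card (prod.swap ` leaf_darts t s) = card (leaf_darts t s)" by (simp add: card_image)
  then show ?thesis
    unfolding remove_edge_darts[OF assms] using fin disj by (simp add: card_Un_disjoint)
qed

section \<open>Moves between trees of the same order\<close>

text \<open>
  Writing the intermediate graph as the union of \<open>t\<close> and \<open>s\<close> makes its symmetry in the two trees visible; in
  particular the cycle picked by \<open>SOME\<close> is the same for both directions.
\<close>

lemma add_step_same_size:
  assumes t: "t \<in> subtrees G" and s: "s \<in> subtrees G" and ne: "s \<noteq> t"
    and num: "num_verts s = num_verts t" and uw: "(u, w) \<in> darts t"
  shows "pmf (add_step t {u, w}) s =
    (if verts s = verts t \<and> edges s - edges t = {{u, w}}
     then 1 / real (card (cycle_edges (SOME c. simple_cycle (UGraph (verts t) (edges t \<union> edges s)) c)))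
     else 0)" (is "_ = (if ?P then ?v else 0)")
proof -
  note T = subtreeD[OF t] and S = subtreeD[OF s] and U = dartsD[OF t uw]
  consider "w \<notin> verts t" | "{u, w} \<in> edges t" | "w \<in> verts t" "{u, w} \<notin> edges t" by blast
  then show ?thesis
  proof cases
    case 1
    have "s \<noteq> attach_leaf t u w" using attach_leaf_card(1)[OF T(1) 1] num by auto
    then have "pmf (add_step t {u, w}) s = 0" by (simp add: add_step_leaf[OF t uw 1] indicator_def)
    moreover have "\<not> ?P" using edge_endpoints(2)[OF S(1), of u w] 1 by auto
    ultimately show ?thesis by (metis (lifting))
  next
    case 2
    then show ?thesis using ne by (auto simp: add_step_present[OF t uw] indicator_def)
  next
    case 3
    define g where "g = add_chord t {u, w}"
    define c where "c = (SOME c. simple_cycle g c)"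
    note g = add_chord_props[OF t uw 3, folded g_def]
    have c: "simple_cycle g c" unfolding c_def by (rule someI_ex[OF g(5)])
    have step: "add_step t {u, w} = map_pmf (delete_edge g) (pmf_of_set (cycle_edges c))"
      using add_step_chord[OF t uw 3] by (simp add: g_def c_def)
    note C = cycle_pmf_uniform(2,3)[OF c g(4)]
    have sub: "cycle_edges c \<subseteq> edges g" using c by (simp add: simple_cycle_def)
    have inj: "inj_on (delete_edge g) (cycle_edges c)"
      using sub by (auto simp: inj_on_def delete_edge_def)
    have gV: "verts g = verts t" and gE: "edges g = insert {u, w} (edges t)" by (simp_all add: g_def add_chord_def)
    show ?thesis
    proof (cases ?P)
      case True
      have "card (edges s) = card (edges t)" using S(3) T(3) num by simp
      then have "card (edges t - edges s) = card (edges s - edges t)"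
        using S(8) T(8) by (simp add: card_Diff_subset_Int Int_commute)
      also have "\<dots> = 1" using True by simp
      finally obtain e where e: "edges t - edges s = {e}" by (metis card_1_singletonE)
      \<comment> \<open>\<open>s\<close> arises from \<open>g\<close> by deleting \<open>e\<close>, and \<open>e\<close> is on the cycle because \<open>s\<close> has no cycle.\<close>
      have Eg: "edges g = edges t \<union> edges s" using gE True by blast
      have "s = delete_edge g e"
        using True gV Eg e by (intro ugraph_eqI) (auto simp: delete_edge_def)
      moreover have "e \<in> cycle_edges c"
        using chord_on_cycle[OF _ _ _ c, of s e] s True gV Eg e by (auto simp: subtrees_iff)
      ultimately have "pmf (add_step t {u, w}) s = 1 / real (card (cycle_edges c))"
        unfolding step using pmf_map_inj[of "delete_edge g" "pmf_of_set (cycle_edges c)" e] inj C by simp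
      moreover have "UGraph (verts t) (edges t \<union> edges s) = g"
        using gV Eg by (intro ugraph_eqI) simp_all
      ultimately show ?thesis using True by (simp add: c_def)
    next
      case False
      have "s \<notin> delete_edge g ` cycle_edges c"
      proof
        assume "s \<in> delete_edge g ` cycle_edges c"
        then obtain e where e: "s = delete_edge g e" by blast
        then have "verts s = verts t" "edges s = insert {u, w} (edges t) - {e}"
          using gV gE by (simp_all add: delete_edge_def)
        moreover from this have "e \<noteq> {u, w}" using subtree_eqI[OF s t num] ne by auto
        ultimately show False using False 3 by auto
      qed
      then have "s \<notin> set_pmf (add_step t {u, w})" using C by (simp add: step)
      then have "pmf (add_step t {u, w}) s = 0" by (simp add: set_pmf_iff)
      with False show ?thesis by (metis (lifting))
    qed
  qed
qed

text \<open>
  The factor 2 counts the two orientations of the added edge; both are darts of \<open>t\<close>, since both endpoints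
  belong to \<open>t\<close>.
\<close>

lemma add_prob_same_size:
  assumes t: "t \<in> subtrees G" and s: "s \<in> subtrees G" and ne: "s \<noteq> t"
    and num: "num_verts s = num_verts t"
  shows "(\<Sum>(u, w)\<in>darts t. pmf (add_step t {u, w}) s) =
    (if verts s = verts t \<and> card (edges s - edges t) = 1
     then 2 / real (card (cycle_edges (SOME c. simple_cycle (UGraph (verts t) (edges t \<union> edges s)) c)))
     else 0)"
proof -
  note T = subtreeD[OF t] and S = subtreeD[OF s]
  define v where
    "v = 1 / real (card (cycle_edges (SOME c. simple_cycle (UGraph (verts t) (edges t \<union> edges s)) c)))"
  let ?D = "{(u, w) \<in> darts t. verts s = verts t \<and> edges s - edges t = {{u, w}}}"
  have "(\<Sum>(u, w)\<in>darts t. pmf (add_step t {u, w}) s) = (\<Sum>x\<in>darts t. if x \<in> ?D then v else 0)"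
  proof (intro sum.cong refl, clarify)
    fix u w assume "(u, w) \<in> darts t"
    then show "pmf (add_step t {u, w}) s = (if (u, w) \<in> ?D then v else 0)"
      using add_step_same_size[OF assms, folded v_def, of u w] by simp
  qed
  also have "\<dots> = real (card (darts t \<inter> ?D)) * v"
    using finite_darts[OF t] by (simp add: sum.If_cases Int_def)
  also have "darts t \<inter> ?D = ?D" by auto
  also have "card ?D = (if verts s = verts t \<and> card (edges s - edges t) = 1 then 2 else 0)"
  proof (cases "verts s = verts t \<and> card (edges s - edges t) = 1")
    case True
    then obtain e where e: "edges s - edges t = {e}" by (metis card_1_singletonE)
    then obtain x y where xy: "e = {x, y}" "x \<noteq> y"
      using S(1) by (metis card_2_iff finite_simple_graph_def insertI1 DiffD1)
    have "{x, y} \<in> edges s" using e xy by blast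
    then have "x \<in> verts t" "y \<in> verts t" "{x, y} \<in> edges G"
      using edge_endpoints[OF S(1)] True S(5) by blast+
    then have "?D = {(x, y), (y, x)}"
      using True e xy by (auto simp: darts_def neighbours_def doubleton_eq_iff insert_commute)
    then show ?thesis using True xy by simp
  next
    case False
    then have "?D = {}" by auto
    then have "card ?D = 0" by (simp only: card.empty)
    with False show ?thesis by (metis (lifting))
  qed
  finally show ?thesis by (simp add: v_def)
qed

text \<open>
  The expression in \<open>add_prob_same_size\<close> is symmetric, because edge sets of equal cardinality
  have differences of equal cardinality.
\<close>

lemma add_prob_same_size_sym:
  assumes t: "t \<in> subtrees G" and s: "s \<in> subtrees G" and ne: "s \<noteq> t"
    and num: "num_verts s = num_verts t"
  shows "(\<Sum>(u, w)\<in>darts t. pmf (add_step t {u, w}) s) = (\<Sum>(u, w)\<in>darts s. pmf (add_step s {u, w}) t)"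
proof -
  have "card (edges s) = card (edges t)" using subtreeD(3)[OF s] subtreeD(3)[OF t] num by simp
  then have "card (edges t - edges s) = card (edges s - edges t)"
    using subtreeD(8)[OF t] subtreeD(8)[OF s] by (simp add: card_Diff_subset_Int Int_commute)
  then show ?thesis
    using add_prob_same_size[OF t s ne num] add_prob_same_size[OF s t ne[symmetric] num[symmetric]]
    by (auto simp: Un_commute)
qed

section \<open>Detailed balance\<close>

lemma kernel_other_size:
  assumes t: "t \<in> subtrees G" and s: "s \<in> subtrees G" and ne: "num_verts s \<noteq> num_verts t"
  shows "pmf (K t) s = (p (num_verts t) * real (card (leaf_darts t s))
      + r (num_verts t) * ((if num_verts s = 1 then 1 else 2) * real (card (leaf_darts s t))))
      / (real (num_verts t) * real d)"
proof -
  have "s \<noteq> t" using ne by auto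
  then show ?thesis
    unfolding kernel_off_diagonal[OF t \<open>s \<noteq> t\<close>] add_prob_other_size[OF t ne]
    using card_remove_edge_darts[OF s t] by simp
qed

lemma kernel_same_size_sym:
  assumes t: "t \<in> subtrees G" and s: "s \<in> subtrees G" and ne: "s \<noteq> t" and num: "num_verts s = num_verts t"
  shows "pmf (K t) s = pmf (K s) t"
proof -
  have "leaf_darts t s = {}" "leaf_darts s t = {}"
    using leaf_darts_num_verts[OF t, of s] leaf_darts_num_verts[OF s, of t] num by auto
  then have "card {x \<in> darts t. remove_edge t x = s} = 0" "card {x \<in> darts s. remove_edge s x = t} = 0"
    unfolding card_remove_edge_darts[OF s t ne[symmetric]] card_remove_edge_darts[OF t s ne] by simp_all
  then show ?thesis
    unfolding kernel_off_diagonal[OF t ne] kernel_off_diagonal[OF s ne[symmetric]]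
      add_prob_same_size_sym[OF t s ne num] num by simp
qed

text \<open>
  The sequence \<open>\<nu>\<close> of the theorem up to the constant \<open>\<nu> 1\<close>. The empty product would give 2 at order 1,
  hence the separate case.
\<close>

definition weight :: "nat \<Rightarrow> real" where
  "weight n = (if n = 1 then 1
     else 2 * (\<Prod>i=2..n. (p (i - 1) / real (i - 1)) / (2 * r i / real i)))"

lemma weight_pos:
  assumes "n \<in> {1..num_verts G}"
  shows "weight n > 0"
proof -
  have "(p (i - 1) / real (i - 1)) / (2 * r i / real i) > 0" if "i \<in> {2..n}" for i
  proof -
    have "p (i - 1) > 0" "r i > 0" using that assms by (auto intro!: p_pos r_pos)
    then show ?thesis using that by simp
  qed
  then have "(\<Prod>i=2..n. (p (i - 1) / real (i - 1)) / (2 * r i / real i)) > 0" by (rule prod_pos)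
  then show ?thesis unfolding weight_def by simp
qed

text \<open>
  The recursion that detailed balance imposes between consecutive orders. The factor 1 or 2 is the number
  of orientations that undo the attachment of a leaf, see \<open>remove_edge_darts\<close>.
\<close>

lemma weight_Suc:
  assumes "1 \<le> n" "n < num_verts G"
  shows "weight n * p n / real n
       = (if n = 1 then 1 else 2) * weight (Suc n) * r (Suc n) / real (Suc n)"
proof -
  have r: "r (Suc n) > 0" using assms by (intro r_pos) auto
  have "(\<Prod>i=2..Suc n. (p (i - 1) / real (i - 1)) / (2 * r i / real i))
      = (\<Prod>i=2..n. (p (i - 1) / real (i - 1)) / (2 * r i / real i))
        * ((p n / real n) / (2 * r (Suc n) / real (Suc n)))"
    using assms by simp
  \<comment> \<open>For \<open>n = 1\<close> the factor 2 of \<open>weight\<close> appears for the first time.\<close>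
  then have W: "weight (Suc n) = (if n = 1 then 2 else weight n) * ((p n / real n) / (2 * r (Suc n) / real (Suc n)))"
    using assms by (auto simp: weight_def)
  have "2 * ((p n / real n) / (2 * r (Suc n) / real (Suc n))) * r (Suc n) / real (Suc n) = p n / real n"
    using r assms by (simp add: field_simps del: of_nat_Suc)
  moreover have "weight n = (if n = 1 then 1 else 2) * (if n = 1 then 2 else weight n) / 2"
    by (simp add: weight_def)
  moreover have "c * (k * x) * y / z = (c * k / 2) * (2 * x * y / z)" for c k x y z :: real
    by simp
  ultimately show ?thesis unfolding W by (metis times_divide_eq_right)
qed

lemma balance_up:
  assumes t: "t \<in> subtrees G" and s: "s \<in> subtrees G" and num: "num_verts s = Suc (num_verts t)"
  shows "weight (num_verts t) * pmf (K t) s = weight (num_verts s) * pmf (K s) t"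
proof -
  define n where "n = num_verts t"
  have n: "1 \<le> n" "n < num_verts G" using subtreeD(9)[OF t] subtreeD(9)[OF s] num by (auto simp: n_def)
  define l where "l = real (card (leaf_darts t s))"
  have L0: "leaf_darts s t = {}" using leaf_darts_num_verts[OF s, of t] num by auto
  have "pmf (K t) s = p n * l / (real n * real d)"
    using kernel_other_size[OF t s] num L0 by (simp add: n_def l_def)
  moreover have "pmf (K s) t = r (Suc n) * ((if n = 1 then 1 else 2) * l) / (real (Suc n) * real d)"
    using kernel_other_size[OF s t] num L0 by (simp add: n_def l_def)
  moreover have "weight n * (p n * l / (real n * real d)) = (weight n * p n / real n) * (l / real d)" by simp
  moreover have "weight (Suc n) * (r (Suc n) * ((if n = 1 then 1 else 2) * l) / (real (Suc n) * real d))
    = ((if n = 1 then 1 else 2) * weight (Suc n) * r (Suc n) / real (Suc n)) * (l / real d)" by simp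
  ultimately have "weight n * pmf (K t) s = weight (Suc n) * pmf (K s) t"
    using weight_Suc[OF n] by metis
  then show ?thesis using num by (simp add: n_def)
qed

text \<open>
  Orders that differ by more than one are not linked by a move in either direction.
\<close>

lemma detailed_balance:
  assumes t: "t \<in> subtrees G" and s: "s \<in> subtrees G"
  shows "weight (num_verts t) * pmf (K t) s = weight (num_verts s) * pmf (K s) t"
proof -
  consider "s = t" | "s \<noteq> t" "num_verts s = num_verts t" | "num_verts s = Suc (num_verts t)"
    | "num_verts t = Suc (num_verts s)"
    | "num_verts s \<noteq> num_verts t" "num_verts s \<noteq> Suc (num_verts t)" "num_verts t \<noteq> Suc (num_verts s)"
    by blast
  then show ?thesis
  proof cases
    case 2 then show ?thesis using kernel_same_size_sym[OF t s] by simp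
  next
    case 3 then show ?thesis using balance_up[OF t s] by simp
  next
    case 4 then show ?thesis using balance_up[OF s t] by simp
  next
    case 5
    then have "leaf_darts t s = {}" "leaf_darts s t = {}"
      using leaf_darts_num_verts[OF t, of s] leaf_darts_num_verts[OF s, of t] by auto
    then show ?thesis using kernel_other_size[OF t s] kernel_other_size[OF s t] 5 by simp
  qed simp
qed

section \<open>Irreducibility\<close>

definition accessible :: "'a ugraph \<Rightarrow> 'a ugraph \<Rightarrow> bool" where
  "accessible = (\<lambda>t s. s \<in> subtrees G \<and> pmf (K t) s > 0)\<^sup>*\<^sup>*"

definition communicate :: "'a ugraph \<Rightarrow> 'a ugraph \<Rightarrow> bool" where
  "communicate t s \<longleftrightarrow> accessible t s \<and> accessible s t"

lemma communicate_refl: "communicate t t"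
  by (simp add: communicate_def accessible_def)

lemma communicate_sym: "communicate t s \<Longrightarrow> communicate s t"
  by (simp add: communicate_def)

lemma communicate_trans: "communicate t s \<Longrightarrow> communicate s u \<Longrightarrow> communicate t u"
  by (auto simp: communicate_def accessible_def)

lemma communicate_leaf:
  assumes t: "t \<in> subtrees G" and uw: "(u, w) \<in> darts t" "w \<notin> verts t"
  shows "communicate t (attach_leaf t u w)"
proof -
  let ?s = "attach_leaf t u w"
  note s = attach_leaf_subtree[OF t uw]
  have num: "num_verts ?s = Suc (num_verts t)" using attach_leaf_card(1)[OF subtreeD(1)[OF t] uw(2)] .
  have "finite (leaf_darts t ?s)"
    using finite_darts[OF t] by (rule finite_subset[rotated]) (auto simp: leaf_darts_def)
  moreover have "(u, w) \<in> leaf_darts t ?s" using uw by (simp add: leaf_darts_def)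
  ultimately have l: "card (leaf_darts t ?s) > 0" by (auto simp: card_gt_0_iff)
  have L0: "leaf_darts ?s t = {}" using leaf_darts_num_verts[OF s, of t] num by auto
  have n: "num_verts t \<in> {1..num_verts G}" "Suc (num_verts t) \<in> {1..num_verts G}"
    using subtreeD(9)[OF t] subtreeD(9)[OF s] num by auto
  have "p (num_verts t) > 0" "r (Suc (num_verts t)) > 0" using n by (auto intro!: p_pos r_pos)
  moreover have "pmf (K t) ?s = p (num_verts t) * real (card (leaf_darts t ?s)) / (real (num_verts t) * real d)"
    using kernel_other_size[OF t s] num L0 by simp
  moreover have "pmf (K ?s) t = r (Suc (num_verts t)) * ((if num_verts t = 1 then 1 else 2) * real (card (leaf_darts t ?s)))
      / (real (Suc (num_verts t)) * real d)"
    using kernel_other_size[OF s t] num L0 by simp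
  ultimately have "pmf (K t) ?s > 0" "pmf (K ?s) t > 0" using l d_pos n by auto
  then show ?thesis using s t by (auto simp: communicate_def accessible_def)
qed

lemma single_vertex_subtree: "v \<in> verts G \<Longrightarrow> UGraph {v} {} \<in> subtrees G"
  by (auto simp: subtrees_iff subgraph_def tree_iff_edge_count finite_simple_graph_def connected_graph_def)

text \<open>
  The chain moves a single vertex to an adjacent one by attaching the other endpoint and then
  removing the edge with the opposite orientation.
\<close>

lemma communicate_adjacent_vertices:
  assumes e: "{u, w} \<in> edges G"
  shows "communicate (UGraph {u} {}) (UGraph {w} {})"
proof -
  have *: "communicate (UGraph {a} {}) (attach_leaf (UGraph {a} {}) a b)" if "{a, b} \<in> edges G" for a b
    using edge_endpoints[OF fsg that] that
    by (intro communicate_leaf single_vertex_subtree) (auto simp: darts_def neighbours_def)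
  have "{w, u} \<in> edges G" using e by (simp add: insert_commute)
  moreover have "attach_leaf (UGraph {u} {}) u w = attach_leaf (UGraph {w} {}) w u"
    by (simp add: attach_leaf_def insert_commute)
  ultimately show ?thesis using *[OF e] *[of w u] communicate_sym communicate_trans by metis
qed

lemma communicate_vertices:
  assumes "u \<in> verts G" "w \<in> verts G"
  shows "communicate (UGraph {u} {}) (UGraph {w} {})"
proof -
  have "reach G u w" using conn assms by (simp add: connected_graph_iff_reach)
  then show ?thesis
  proof (induction rule: reach_induct)
    case (step y z)
    then show ?case using communicate_adjacent_vertices communicate_trans by blast
  qed (rule communicate_refl)
qed

text \<open>
  A tree of order \<open>n + 1\<close> contains a subtree \<open>H\<close> of order \<open>n\<close> and is obtained from it
  by attaching a leaf, because the enlarged subtree already has all vertices, hence as many edges as the tree.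
\<close>

lemma communicate_with_vertex:
  "t \<in> subtrees G \<Longrightarrow> num_verts t = Suc n \<Longrightarrow> \<exists>v\<in>verts G. communicate (UGraph {v} {}) t"
proof (induction n arbitrary: t)
  case 0
  then obtain v where v: "verts t = {v}" by (metis One_nat_def card_1_singletonE)
  have "edges t = {}" using subtreeD(3,8)[OF 0(1)] 0(2) by simp
  then have "t = UGraph {v} {}" using v by (intro ugraph_eqI) auto
  then show ?case using v subtreeD(4)[OF 0(1)] communicate_refl by auto
next
  case (Suc n)
  note T = subtreeD[OF Suc.prems(1)]
  obtain H where H: "subgraph H t" "finite_simple_graph H" "connected_graph H"
    "num_verts H = Suc n" "card (edges H) + 1 = Suc n"
    using grow_connected_subgraph[OF T(1,2), of "Suc n"] Suc.prems by auto
  then have HS: "H \<in> subtrees G" using T by (auto simp: subtrees_iff tree_iff_edge_count subgraph_def)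
  have "verts H \<noteq> {}" "verts H \<noteq> verts t" "verts H \<subseteq> verts t"
    using H Suc.prems by (auto simp: subgraph_def)
  then obtain u w where uw: "u \<in> verts H" "w \<in> verts t - verts H" "{u, w} \<in> edges t"
    using crossing_edge[OF T(1,2), of H] by blast
  then have dart: "(u, w) \<in> darts H" using T by (auto simp: darts_def neighbours_def)
  note s = attach_leaf_subtree[OF HS dart]
  have num: "num_verts (attach_leaf H u w) = num_verts t"
    using attach_leaf_card(1)[OF H(2), of w u] uw H(4) Suc.prems by simp
  have "verts (attach_leaf H u w) = verts t"
    using T(6) num H(1) uw by (intro card_subset_eq) (auto simp: subgraph_def)
  then have "attach_leaf H u w = t"
    using s uw H(1) num Suc.prems(1) by (intro subtree_eqI) (auto simp: subgraph_def)
  then have "communicate H t" using communicate_leaf[OF HS dart] uw by simp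
  with Suc.IH[OF HS H(4)] show ?case using communicate_trans by blast
qed

lemma irreducible:
  assumes "t \<in> subtrees G" "s \<in> subtrees G"
  shows "accessible t s"
proof -
  have "\<exists>v\<in>verts G. communicate (UGraph {v} {}) x" if "x \<in> subtrees G" for x
    using communicate_with_vertex[OF that, of "num_verts x - 1"] subtreeD(9)[OF that] by auto
  then obtain v w where "v \<in> verts G" "communicate (UGraph {v} {}) t" "w \<in> verts G" "communicate (UGraph {w} {}) s"
    using assms by meson
  then have "communicate t s" using communicate_vertices communicate_sym communicate_trans by meson
  then show ?thesis by (simp add: communicate_def)
qed

section \<open>The invariant law\<close>

definition total_weight :: real where
  "total_weight = (\<Sum>t\<in>subtrees G. weight (num_verts t))"

definition stationary :: "'a ugraph pmf" where
  "stationary = embed_pmf (\<lambda>t. if t \<in> subtrees G then weight (num_verts t) / total_weight else 0)"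

lemma total_weight_pos: "total_weight > 0"
proof -
  have "verts G \<noteq> {}" using two_verts by auto
  then have "subtrees G \<noteq> {}" using single_vertex_subtree by blast
  then show ?thesis unfolding total_weight_def
    using finite_subtrees[OF fsg] weight_pos subtreeD(9) by (intro sum_pos) auto
qed

lemma pmf_stationary:
  "pmf stationary t = (if t \<in> subtrees G then weight (num_verts t) / total_weight else 0)"
  unfolding stationary_def
proof (rule pmf_embed_finite_support)
  show "0 \<le> weight (num_verts t) / total_weight" if "t \<in> subtrees G" for t
    using weight_pos[OF subtreeD(9)[OF that]] total_weight_pos by simp
  show "(\<Sum>t\<in>subtrees G. weight (num_verts t) / total_weight) = 1"
    using total_weight_pos by (simp add: sum_divide_distrib[symmetric] total_weight_def[symmetric])
qed (rule finite_subtrees[OF fsg])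

lemma set_pmf_stationary: "set_pmf stationary = subtrees G"
proof (rule set_eqI)
  fix t
  show "t \<in> set_pmf stationary \<longleftrightarrow> t \<in> subtrees G"
    using weight_pos[OF subtreeD(9), of t] total_weight_pos by (auto simp: set_pmf_iff pmf_stationary)
qed

lemma reversible_stationary: "reversible_wrt (subtrees G) K stationary"
  unfolding reversible_wrt_def using detailed_balance by (auto simp: pmf_stationary field_simps)

lemma invariant_iff_stationary: "invariant_pmf (subtrees G) K \<rho> \<longleftrightarrow> \<rho> = stationary"
  using finite_subtrees[OF fsg] kernel_closed reversible_stationary set_pmf_stationary
    irreducible[unfolded accessible_def]
  by (rule invariant_pmf_iff_reversible)

lemma sum_by_order:
  "(\<Sum>n=1..num_verts G. f n * real (card (subtrees_of_order G n))) = (\<Sum>t\<in>subtrees G. f (num_verts t))"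
proof -
  have "(\<Sum>n=1..num_verts G. f n * real (card (subtrees_of_order G n)))
      = (\<Sum>n=1..num_verts G. \<Sum>t\<in>{t \<in> subtrees G. num_verts t = n}. f (num_verts t))"
    by (intro sum.cong) (auto simp: subtrees_of_order_eq)
  also have "\<dots> = (\<Sum>t\<in>subtrees G. f (num_verts t))"
    using finite_subtrees[OF fsg] subtreeD(9) by (intro sum.group) auto
  finally show ?thesis .
qed

lemma subtrees_of_order_nonempty:
  assumes "n \<in> {1..num_verts G}"
  shows "subtrees_of_order G n \<noteq> {}"
  using grow_connected_subgraph[OF fsg conn, of n] assms
  by (auto simp: subtrees_of_order_def tree_iff_edge_count)

lemma cond_stationary:
  assumes n: "n \<in> {1..num_verts G}"
  shows "cond_pmf stationary {t. num_verts t = n} = pmf_of_set (subtrees_of_order G n)"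
proof (rule pmf_eqI)
  fix t
  let ?A = "{t. num_verts t = n}" and ?S = "subtrees_of_order G n"
  have S: "?S \<noteq> {}" "finite ?S" "?S = ?A \<inter> subtrees G"
    using subtrees_of_order_nonempty[OF n] finite_subtrees[OF fsg] by (auto simp: subtrees_of_order_eq)
  have ne: "set_pmf stationary \<inter> ?A \<noteq> {}" using S set_pmf_stationary by auto
  have "measure stationary ?A = measure stationary ?S"
    using measure_Int_set_pmf[of stationary ?A] S(3) by (simp add: set_pmf_stationary)
  also have "\<dots> = (\<Sum>t\<in>?S. weight n / total_weight)"
    unfolding measure_measure_pmf_finite[OF S(2)]
    by (intro sum.cong) (auto simp: pmf_stationary subtrees_of_order_eq)
  also have "\<dots> = real (card ?S) * (weight n / total_weight)" by simp
  finally have M: "measure stationary ?A = \<dots>" .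
  have "weight n / total_weight > 0" using weight_pos[OF n] total_weight_pos by simp
  then show "pmf (cond_pmf stationary ?A) t = pmf (pmf_of_set ?S) t"
    unfolding pmf_cond[OF ne] pmf_of_set[OF S(1,2)] M
    by (auto simp: pmf_stationary subtrees_of_order_eq indicator_def)
qed

end

theorem proposition19:
  fixes G :: "'a ugraph" and p q r :: "nat \<Rightarrow> real"
  assumes "finite_simple_graph G"
    and "connected_graph G"
    and "num_verts G \<ge> 2"
    and "\<exists>d. \<forall>v\<in>verts G. vertex_degree G v = d"
    and "\<forall>i\<in>{1..num_verts G}. p i \<ge> 0 \<and> q i \<ge> 0 \<and> r i \<ge> 0 \<and> p i + q i + r i = 1"
    and "\<forall>i\<in>{2..num_verts G}. r i > 0"
    and "\<forall>i\<in>{1..num_verts G - 1}. p i > 0"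
  shows "\<exists>(\<rho> :: 'a ugraph pmf) (\<nu> :: nat \<Rightarrow> real).
      (\<forall>\<rho>'. invariant_pmf (subtrees G) (subtree_kernel G p q r) \<rho>' \<longleftrightarrow> \<rho>' = \<rho>) \<and>
      reversible_wrt (subtrees G) (subtree_kernel G p q r) \<rho> \<and>
      (\<forall>t\<in>subtrees G. pmf \<rho> t = \<nu> (num_verts t)) \<and>
      (\<forall>m\<in>{2..num_verts G}.
         \<nu> m = 2 * \<nu> 1 * (\<Prod>i=2..m. (p (i - 1) / real (i - 1)) / (2 * r i / real i))) \<and>
      (\<Sum>n=1..num_verts G. \<nu> n * real (card (subtrees_of_order G n))) = 1 \<and>
      (\<forall>n\<in>{1..num_verts G}.
         cond_pmf \<rho> {t. num_verts t = n} = pmf_of_set (subtrees_of_order G n))"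
proof -
  obtain d where d: "\<forall>v\<in>verts G. vertex_degree G v = d" using assms(4) by blast
  interpret regular_subtree_chain G p q r d
    by unfold_locales (use assms d in auto)
  let ?\<nu> = "\<lambda>n. weight n / total_weight"
  show ?thesis
  proof (intro exI[of _ stationary] exI[of _ ?\<nu>] conjI allI ballI)
    show "invariant_pmf (subtrees G) K \<rho>' \<longleftrightarrow> \<rho>' = stationary" for \<rho>'
      by (rule invariant_iff_stationary)
    show "reversible_wrt (subtrees G) K stationary" by (rule reversible_stationary)
    show "pmf stationary t = ?\<nu> (num_verts t)" if "t \<in> subtrees G" for t
      using that by (simp add: pmf_stationary)
    show "?\<nu> m = 2 * ?\<nu> 1 * (\<Prod>i=2..m. (p (i - 1) / real (i - 1)) / (2 * r i / real i))"
      if "m \<in> {2..num_verts G}" for m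
      using that by (simp add: weight_def)
    show "(\<Sum>n=1..num_verts G. ?\<nu> n * real (card (subtrees_of_order G n))) = 1"
      unfolding sum_by_order using total_weight_pos
      by (simp add: sum_divide_distrib[symmetric] total_weight_def[symmetric])
    show "cond_pmf stationary {t. num_verts t = n} = pmf_of_set (subtrees_of_order G n)"
      if "n \<in> {1..num_verts G}" for n
      using that by (rule cond_stationary)
  qed
qed

end
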